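(* Consider the asynchronous model over the additive white Gaussian noise channel: input $x\in\mathbb{R}$, output $Y=x+Z$ with $Z\sim\mathcal{N}(0,N_0/2)$ independent across time. The idle symbol is $\star=0$, and the cost function is quadratic, $k(x)=x^2$. Then for every $\beta\ge0$, the asynchronous capacity per unit cost at delay exponent $\delta=0$ is $$\mathbf{C}(\beta)=\frac{1}{1+\beta}\cdot\frac{\log_2 e}{N_0}.$$
   Context: Asynchronous channel model (here with real input and output alphabets). All logarithms are base 2. Codes. To transmit $B$ bits, a codebook $\mathcal{C}$ consists of $2^B$ codewords $c(m)\in\mathbb{R}^N$; the length $N$ is free. The message $m$ arrives at a time $\nu$, independent of $m$ and uniform on $\{1,\dots,A\}$. Transmission starts at $\sigma(\nu,m)$ with $\nu\le\sigma\le A$. Outputs. Conditioned on $\nu=t$ and $m$, the outputs $Y_1,\dots,Y_{A+N-1}$ are independent. For $i<\sigma$ or $i\ge\sigma+N$, $Y_i$ is distributed as the channel output for the idle input $\star$. For $\sigma\le i\le\sigma+N-1$, $Y_i$ is the channel output for input $c_{i-\sigma+1}(m)$. Decoder. The receiver knows $A$ but not $\nu$. It decodes with a stopping time $\tau\le A+N-1$ with respect to the outputs and a decision $\phi$ measurable with respect to $Y_1,\dots,Y_\tau$. Error probability. $\Pr(\mathcal{E}|\mathcal{C})=\max_m\frac1A\sum_t\Pr_{m,t}(\mathcal{E})$. Cost. The cost of a code is $\mathcal{K}(\mathcal{C})=\max_m\sum_i k(c_i(m))$. Delay. $\mathcal{D}(\mathcal{C},\varepsilon)$ is the smallest $d$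 with $\min_m\Pr_m(\tau-\nu\le d)\ge1-\varepsilon$, where $\Pr_m=\frac1A\sum_t\Pr_{m,t}$. Rate per unit cost. Set $A=2^{\beta B}$. A number $R$ is achievable at $(\beta,\delta)$ if there are codes $\mathcal{C}_B$ and $\varepsilon_B\to0$ such that: - $\Pr(\mathcal{E}|\mathcal{C}_B)\le\varepsilon_B$; - $\limsup_B\frac1B\log\mathcal{D}(\mathcal{C}_B,\varepsilon_B)\le\delta$; - $\liminf_B B/\mathcal{K}(\mathcal{C}_B)\ge R$. $\mathbf{C}(\beta,\delta)$ is the supremum of achievable $R$, and $\mathbf{C}(\beta)=\mathbf{C}(\beta,0)$. *)

theory Defs
  imports "HOL-Probability.Probability"
begin

text \<open>A transmission scheme for the asynchronous channel: codeword length N,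
codebook (message m, position i in 1..N), start times sigma(t,m), stopping
time tau and decision phi, both functions of the output sequence
(outputs are indexed 1..A+N-1).\<close>

record ascheme =
  len   :: nat
  cw    :: "nat \<Rightarrow> nat \<Rightarrow> real"
  start :: "nat \<Rightarrow> nat \<Rightarrow> nat"
  stop  :: "(nat \<Rightarrow> real) \<Rightarrow> nat"
  dec   :: "(nat \<Rightarrow> real) \<Rightarrow> nat"

definition horizon :: "nat \<Rightarrow> ascheme \<Rightarrow> nat" where
  "horizon A C = A + len C - 1"

definition gauss :: "real \<Rightarrow> real \<Rightarrow> real measure" where
  "gauss N0 x = density lborel (normal_density x (sqrt (N0 / 2)))"

definition obs :: "nat \<Rightarrow> ascheme \<Rightarrow> (nat \<Rightarrow> real) measure" where
  "obs A C = PiM {1..horizon A C} (\<lambda>_. borel)"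

text \<open>Law of the outputs given nu = t and message m (idle symbol 0).\<close>
definition out_meas :: "real \<Rightarrow> nat \<Rightarrow> ascheme \<Rightarrow> nat \<Rightarrow> nat \<Rightarrow> (nat \<Rightarrow> real) measure" where
  "out_meas N0 A C t m = PiM {1..horizon A C}
     (\<lambda>i. if start C t m \<le> i \<and> i \<le> start C t m + len C - 1
          then gauss N0 (cw C m (i - start C t m + 1)) else gauss N0 0)"

definition valid_scheme :: "nat \<Rightarrow> nat \<Rightarrow> ascheme \<Rightarrow> bool" where
  "valid_scheme A M C \<longleftrightarrow>
     len C \<ge> 1 \<and>
     (\<forall>t\<in>{1..A}. \<forall>m<M. t \<le> start C t m \<and> start C t m \<le> A) \<and>
     (\<forall>y\<in>space (obs A C). stop C y \<le> horizon A C) \<and>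
     (\<forall>n. {y\<in>space (obs A C). stop C y = n} \<in> sets (obs A C)) \<and>
     (\<forall>n y y'. y \<in> space (obs A C) \<and> y' \<in> space (obs A C) \<and> (\<forall>i\<in>{1..n}. y i = y' i)
        \<longrightarrow> (stop C y = n \<longleftrightarrow> stop C y' = n)) \<and>
     dec C \<in> measurable (obs A C) (count_space UNIV) \<and>
     (\<forall>y y'. y \<in> space (obs A C) \<and> y' \<in> space (obs A C) \<and> (\<forall>i\<in>{1..stop C y}. y i = y' i)
        \<longrightarrow> dec C y = dec C y')"

definition err_prob :: "real \<Rightarrow> nat \<Rightarrow> nat \<Rightarrow> ascheme \<Rightarrow> real" where
  "err_prob N0 A M C = Max ((\<lambda>m. (\<Sum>t=1..A. measure (out_meas N0 A C t m)
        {y\<in>space (out_meas N0 A C t m). dec C y \<noteq> m}) / real A) ` {..<M})"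

definition delay_prob :: "real \<Rightarrow> nat \<Rightarrow> ascheme \<Rightarrow> nat \<Rightarrow> nat \<Rightarrow> real" where
  "delay_prob N0 A C m d = (\<Sum>t=1..A. measure (out_meas N0 A C t m)
        {y\<in>space (out_meas N0 A C t m). int (stop C y) - int t \<le> int d}) / real A"

definition delay :: "real \<Rightarrow> nat \<Rightarrow> nat \<Rightarrow> ascheme \<Rightarrow> real \<Rightarrow> nat" where
  "delay N0 A M C eps = (LEAST d. \<forall>m<M. delay_prob N0 A C m d \<ge> 1 - eps)"

definition cost :: "nat \<Rightarrow> ascheme \<Rightarrow> real" where
  "cost M C = Max ((\<lambda>m. \<Sum>i=1..len C. (cw C m i)\<^sup>2) ` {..<M})"

definition asyn :: "real \<Rightarrow> nat \<Rightarrow> nat" where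
  "asyn \<beta> B = nat \<lceil>2 powr (\<beta> * real B)\<rceil>"

text \<open>Achievability of rate per unit cost R at (beta, delta). The limsup/liminf
conditions are written out: limsup (1/B) log D \<le> delta iff for all e>0 eventually
D \<le> 2^((delta+e)B); liminf B/K \<ge> R iff for all e>0 eventually (R-e) K \<le> B
(with B/0 = +infinity).\<close>
definition achievable :: "real \<Rightarrow> real \<Rightarrow> real \<Rightarrow> real \<Rightarrow> bool" where
  "achievable N0 \<beta> \<delta> R \<longleftrightarrow>
    (\<exists>C :: nat \<Rightarrow> ascheme. \<exists>eps :: nat \<Rightarrow> real.
       eps \<longlonglongrightarrow> 0 \<and>
       (\<forall>B. valid_scheme (asyn \<beta> B) (2 ^ B) (C B)) \<and>
       (\<forall>B. err_prob N0 (asyn \<beta> B) (2 ^ B) (C B) \<le> eps B) \<and>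
       (\<forall>e>0. eventually (\<lambda>B. real (delay N0 (asyn \<beta> B) (2 ^ B) (C B) (eps B))
                                 \<le> 2 powr ((\<delta> + e) * real B)) sequentially) \<and>
       (\<forall>e>0. eventually (\<lambda>B. (R - e) * cost (2 ^ B) (C B) \<le> real B) sequentially))"

definition async_capacity :: "real \<Rightarrow> real \<Rightarrow> real \<Rightarrow> real" where
  "async_capacity N0 \<beta> \<delta> = Sup {R. achievable N0 \<beta> \<delta> R}"

end

theory Submission
  imports Defs "HOL-Real_Asymp.Real_Asymp"
begin

text \<open>Converse. Let Q be the law of a purely idle output. The events (tau between t and t + d,
  phi = m) have Q-probabilities that sum to at most d + 1 over all A * M pairs (t, m), whereas
  they have probability close to one, on average, under the law P of the pair: a stop before t
  with decision m is as likely under P as under Q, and these probabilities sum to at most 1 over m.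
  A Chernoff-type change of measure, with the (1 + s)-th moment of dP/dQ equal to
  exp (s (1 + s) K / N0) for energy K, then forces (1 + s) K / N0 to be at least about
  ln (A * M / (d + 1)).

  Achievability. Pulse position codewords whose positions pairwise agree in few places (greedy
  choice) are almost orthogonal at length linear in B. With equal energies E, a correlator with
  threshold (1 - eta) E finds the codeword among A * M hypotheses as soon as E / N0 exceeds
  ln (A * M) by a fixed factor.\<close>

subsection \<open>Products of Gaussian measures\<close>

lemma sets_gauss [measurable_cong, simp]: "sets (gauss N0 x) = sets borel"
  and space_gauss [simp]: "space (gauss N0 x) = UNIV"
  by (simp_all add: gauss_def)

lemma prob_space_gauss: "N0 > 0 \<Longrightarrow> prob_space (gauss N0 x)"
  unfolding gauss_def by (rule prob_space_normal_density) simp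

text \<open>Completing the square: an exponential tilt by \<open>a\<close> moves the mean by
  \<open>a\<close> times the variance and leaves the variance alone. The prefactor is therefore the
  moment generating function.\<close>

lemma normal_density_tilt:
  assumes "\<sigma> > 0"
  shows "exp (a * y) * normal_density x \<sigma> y =
    exp (a * x + a\<^sup>2 * \<sigma>\<^sup>2 / 2) * normal_density (x + a * \<sigma>\<^sup>2) \<sigma> y"
proof -
  have "a * y + - (y - x)\<^sup>2 / (2 * \<sigma>\<^sup>2) =
      (a * x + a\<^sup>2 * \<sigma>\<^sup>2 / 2) + - (y - (x + a * \<sigma>\<^sup>2))\<^sup>2 / (2 * \<sigma>\<^sup>2)"
    using assms by (simp add: field_simps power2_eq_square)
  then have "exp (a * y) * exp (- (y - x)\<^sup>2 / (2 * \<sigma>\<^sup>2)) =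
      exp (a * x + a\<^sup>2 * \<sigma>\<^sup>2 / 2) * exp (- (y - (x + a * \<sigma>\<^sup>2))\<^sup>2 / (2 * \<sigma>\<^sup>2))"
    by (simp only: flip: exp_add)
  then show ?thesis
    by (simp add: normal_density_def)
qed

lemma nn_integral_exp_gauss:
  assumes "N0 > 0"
  shows "(\<integral>\<^sup>+ y. ennreal (exp (a * y)) \<partial>gauss N0 x) = ennreal (exp (a * x + a\<^sup>2 * N0 / 4))"
proof -
  define \<sigma> where "\<sigma> = sqrt (N0 / 2)"
  have \<sigma>: "\<sigma> > 0" "\<sigma>\<^sup>2 = N0 / 2" using assms by (auto simp: \<sigma>_def)
  interpret D: prob_space "density lborel (normal_density (x + a * \<sigma>\<^sup>2) \<sigma>)"
    by (rule prob_space_normal_density[OF \<sigma>(1)])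
  have "(\<integral>\<^sup>+ y. ennreal (exp (a * y)) \<partial>gauss N0 x) =
      (\<integral>\<^sup>+ y. ennreal (exp (a * y) * normal_density x \<sigma> y) \<partial>lborel)"
    unfolding gauss_def \<sigma>_def[symmetric]
    by (subst nn_integral_density) (auto simp: ennreal_mult mult.commute)
  also have "\<dots> = (\<integral>\<^sup>+ y. ennreal (exp (a * x + a\<^sup>2 * \<sigma>\<^sup>2 / 2)) *
      ennreal (normal_density (x + a * \<sigma>\<^sup>2) \<sigma> y) \<partial>lborel)"
    by (simp add: normal_density_tilt[OF \<sigma>(1)] ennreal_mult)
  also have "\<dots> = ennreal (exp (a * x + a\<^sup>2 * \<sigma>\<^sup>2 / 2)) *
      emeasure (density lborel (normal_density (x + a * \<sigma>\<^sup>2) \<sigma>)) UNIV"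
    by (subst nn_integral_cmult) (auto simp: emeasure_density)
  also have "emeasure (density lborel (normal_density (x + a * \<sigma>\<^sup>2) \<sigma>)) UNIV = 1"
    using D.emeasure_space_1 by simp
  finally show ?thesis by (simp add: \<sigma>(2))
qed

text \<open>The quadratic terms in \<open>y\<close> cancel between the two densities, so the
  log-likelihood ratio against the idle law is affine in \<open>y\<close>. Its exponential moments
  are then again Gaussian moment generating functions.\<close>

lemma gauss_density_zero:
  assumes "N0 > 0"
  shows "gauss N0 x = density (gauss N0 0) (\<lambda>y. ennreal (exp ((2 * x * y - x\<^sup>2) / N0)))"
proof -
  define \<sigma> where "\<sigma> = sqrt (N0 / 2)"
  have \<sigma>: "\<sigma> > 0" "\<sigma>\<^sup>2 = N0 / 2" using assms by (auto simp: \<sigma>_def)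
  have "normal_density x \<sigma> y = exp ((2 * x * y - x\<^sup>2) / N0) * normal_density 0 \<sigma> y" for y
  proof -
    have "- (y - x)\<^sup>2 / (2 * \<sigma>\<^sup>2) = (2 * x * y - x\<^sup>2) / N0 + - (y - 0)\<^sup>2 / (2 * \<sigma>\<^sup>2)"
      unfolding \<sigma>(2) using assms by (simp add: field_simps power2_eq_square)
    then have "exp (- (y - x)\<^sup>2 / (2 * \<sigma>\<^sup>2)) =
        exp ((2 * x * y - x\<^sup>2) / N0) * exp (- (y - 0)\<^sup>2 / (2 * \<sigma>\<^sup>2))"
      by (simp only: flip: exp_add)
    then show ?thesis by (simp add: normal_density_def)
  qed
  then show ?thesis
    unfolding gauss_def \<sigma>_def[symmetric]
    by (subst density_density_eq) (auto simp: ennreal_mult mult.commute)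
qed

definition gvec :: "real \<Rightarrow> 'i set \<Rightarrow> ('i \<Rightarrow> real) \<Rightarrow> ('i \<Rightarrow> real) measure" where
  "gvec N0 I x = PiM I (\<lambda>i. gauss N0 (x i))"

lemma sets_gvec [measurable_cong]: "sets (gvec N0 I x) = sets (PiM I (\<lambda>_. borel))"
  unfolding gvec_def by (rule sets_PiM_cong) auto

lemma space_gvec: "space (gvec N0 I x) = space (PiM I (\<lambda>_. borel))"
  by (rule sets_eq_imp_space_eq) (rule sets_gvec)

lemma product_prob_space_gauss: "N0 > 0 \<Longrightarrow> product_prob_space (\<lambda>i. gauss N0 (x i))"
  by (intro product_prob_space.intro product_prob_space_axioms.intro product_sigma_finite.intro
      prob_space_imp_sigma_finite prob_space_gauss)

lemma prob_space_gvec: "N0 > 0 \<Longrightarrow> prob_space (gvec N0 I x)"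
  unfolding gvec_def by (intro prob_space_PiM prob_space_gauss)

lemma nn_integral_exp_gvec:
  assumes "N0 > 0" "finite I"
  shows "(\<integral>\<^sup>+ y. ennreal (exp (\<Sum>i\<in>I. a i * y i)) \<partial>gvec N0 I x) =
    ennreal (exp ((\<Sum>i\<in>I. a i * x i) + (\<Sum>i\<in>I. (a i)\<^sup>2) * N0 / 4))"
proof -
  interpret product_prob_space "\<lambda>i. gauss N0 (x i)" I
    by (rule product_prob_space_gauss) fact
  have "(\<integral>\<^sup>+ y. ennreal (exp (\<Sum>i\<in>I. a i * y i)) \<partial>gvec N0 I x) =
      (\<integral>\<^sup>+ y. (\<Prod>i\<in>I. ennreal (exp (a i * y i))) \<partial>gvec N0 I x)"
    by (simp add: exp_sum assms prod_ennreal)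
  also have "\<dots> = (\<Prod>i\<in>I. ennreal (exp (a i * x i + (a i)\<^sup>2 * N0 / 4)))"
    unfolding gvec_def
    by (subst product_nn_integral_prod) (auto simp: assms nn_integral_exp_gauss)
  also have "\<dots> = ennreal (exp (\<Sum>i\<in>I. a i * x i + (a i)\<^sup>2 * N0 / 4))"
    by (simp add: exp_sum assms prod_ennreal)
  also have "(\<Sum>i\<in>I. a i * x i + (a i)\<^sup>2 * N0 / 4) =
      (\<Sum>i\<in>I. a i * x i) + (\<Sum>i\<in>I. (a i)\<^sup>2) * N0 / 4"
    by (simp add: sum.distrib sum_distrib_right sum_divide_distrib)
  finally show ?thesis .
qed

text \<open>A product measure is determined by its values on boxes. On a box both the likelihood
  ratio and the indicator factor over the coordinates, which reduces the claim to one
  dimension.\<close>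

lemma gvec_density_zero:
  assumes "N0 > 0" "finite I"
  shows "gvec N0 I x = density (gvec N0 I (\<lambda>_. 0))
    (\<lambda>y. ennreal (exp (\<Sum>i\<in>I. (2 * x i * y i - (x i)\<^sup>2) / N0)))"
proof -
  interpret P: product_prob_space "\<lambda>i. gauss N0 (x i)" I
    by (rule product_prob_space_gauss) fact
  interpret Q: product_prob_space "\<lambda>i. gauss N0 0" I
    by (rule product_prob_space_gauss) fact
  let ?L = "\<lambda>y. ennreal (exp (\<Sum>i\<in>I. (2 * x i * y i - (x i)\<^sup>2) / N0))"
  have "density (gvec N0 I (\<lambda>_. 0)) ?L = PiM I (\<lambda>i. gauss N0 (x i))"
  proof (rule P.PiM_eqI)
    show "sets (density (gvec N0 I (\<lambda>_. 0)) ?L) = sets (PiM I (\<lambda>i. gauss N0 (x i)))"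
      using sets_gvec[of N0 I x] sets_gvec[of N0 I "\<lambda>_. 0"] by (simp add: gvec_def)
  next
    fix B assume B: "\<And>i. i \<in> I \<Longrightarrow> B i \<in> sets (gauss N0 (x i))"
    have B': "Pi\<^sub>E I B \<in> sets (gvec N0 I (\<lambda>_. 0))"
      unfolding gvec_def using B assms by (auto intro!: sets_PiM_I_finite)
    have "emeasure (density (gvec N0 I (\<lambda>_. 0)) ?L) (Pi\<^sub>E I B) =
        (\<integral>\<^sup>+ y. ?L y * indicator (Pi\<^sub>E I B) y \<partial>gvec N0 I (\<lambda>_. 0))"
      by (subst emeasure_density) (use B' in auto)
    also have "\<dots> = (\<integral>\<^sup>+ y. (\<Prod>i\<in>I. ennreal (exp ((2 * x i * y i - (x i)\<^sup>2) / N0)) *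
        indicator (B i) (y i)) \<partial>gvec N0 I (\<lambda>_. 0))"
    proof (rule nn_integral_cong)
      fix y assume "y \<in> space (gvec N0 I (\<lambda>_. 0))"
      then have y: "y \<in> extensional I" by (auto simp: space_gvec space_PiM PiE_def)
      \<comment> \<open>Since \<open>y\<close> is extensional, lying outside the box means that some
        coordinate in \<open>I\<close> leaves its side, and that factor vanishes.\<close>
      have "(indicator (Pi\<^sub>E I B) y :: ennreal) = (\<Prod>i\<in>I. indicator (B i) (y i))"
      proof (cases "y \<in> Pi\<^sub>E I B")
        case False
        then obtain i where "i \<in> I" "y i \<notin> B i" using y by (auto simp: PiE_def Pi_def)
        then have "(\<Prod>i\<in>I. indicator (B i) (y i) :: ennreal) = 0"
          using assms by (intro prod_zero) (auto intro!: bexI[of _ i])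
        with False show ?thesis by simp
      qed (auto simp: indicator_def PiE_iff intro!: prod.neutral[symmetric])
      then show "?L y * indicator (Pi\<^sub>E I B) y =
          (\<Prod>i\<in>I. ennreal (exp ((2 * x i * y i - (x i)\<^sup>2) / N0)) * indicator (B i) (y i))"
        by (simp add: exp_sum assms prod_ennreal prod.distrib)
    qed
    also have "\<dots> = (\<Prod>i\<in>I. \<integral>\<^sup>+ z. ennreal (exp ((2 * x i * z - (x i)\<^sup>2) / N0)) *
        indicator (B i) z \<partial>gauss N0 0)"
      unfolding gvec_def using B assms by (subst Q.product_nn_integral_prod) auto
    also have "\<dots> = (\<Prod>i\<in>I. emeasure (gauss N0 (x i)) (B i))"
    proof (rule prod.cong[OF refl])
      fix i assume "i \<in> I"
      then show "(\<integral>\<^sup>+ z. ennreal (exp ((2 * x i * z - (x i)\<^sup>2) / N0)) * indicator (B i) z \<partial>gauss N0 0) =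
          emeasure (gauss N0 (x i)) (B i)"
        using B[of i] by (subst (2) gauss_density_zero[OF assms(1)]) (auto simp: emeasure_density)
    qed
    finally show "emeasure (density (gvec N0 I (\<lambda>_. 0)) ?L) (Pi\<^sub>E I B) =
        (\<Prod>i\<in>I. emeasure (gauss N0 (x i)) (B i))" .
  qed (use assms in auto)
  then show ?thesis by (simp add: gvec_def)
qed

section \<open>Tail bounds and change of measure for Gaussian vectors\<close>

text \<open>Markov's inequality for the exponential of a linear statistic with variance
  \<open>N0 * V / 2\<close>. Only an upper bound \<rho> on its mean enters, which is enough because
  the tilt \<open>r\<close> is nonnegative.\<close>

lemma gvec_chernoff:
  assumes "N0 > 0" "finite I" and V: "(\<Sum>i\<in>I. (a i)\<^sup>2) = V" "V > 0"
    and \<rho>: "(\<Sum>i\<in>I. a i * x i) \<le> \<rho>" "\<rho> \<le> T"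
  shows "measure (gvec N0 I x) {y \<in> space (gvec N0 I x). T \<le> (\<Sum>i\<in>I. a i * y i)}
    \<le> exp (- (T - \<rho>)\<^sup>2 / (N0 * V))"
proof -
  interpret prob_space "gvec N0 I x" by (rule prob_space_gvec) fact
  \<comment> \<open>The minimiser of
    \<open>- r * (T - \<rho>) + r\<^sup>2 * V * N0 / 4\<close>.\<close>
  define r where "r = 2 * (T - \<rho>) / (N0 * V)"
  have r: "r \<ge> 0" using assms by (simp add: r_def)
  let ?E = "{y \<in> space (gvec N0 I x). T \<le> (\<Sum>i\<in>I. a i * y i)}"
  have meas: "?E \<in> sets (gvec N0 I x)" by measurable
  have "emeasure (gvec N0 I x) ?E = (\<integral>\<^sup>+ y. indicator ?E y \<partial>gvec N0 I x)"
    using meas by simp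
  also have "\<dots> \<le> (\<integral>\<^sup>+ y. ennreal (exp (- r * T)) * ennreal (exp (\<Sum>i\<in>I. (r * a i) * y i)) \<partial>gvec N0 I x)"
  proof (rule nn_integral_mono)
    fix y
    show "indicator ?E y \<le> ennreal (exp (- r * T)) * ennreal (exp (\<Sum>i\<in>I. (r * a i) * y i))"
    proof (cases "y \<in> ?E")
      case True
      then have "r * T \<le> r * (\<Sum>i\<in>I. a i * y i)" using r by (intro mult_left_mono) auto
      then have "1 \<le> exp (- r * T) * exp (\<Sum>i\<in>I. (r * a i) * y i)"
        by (simp add: sum_distrib_left mult.assoc flip: exp_add)
      then show ?thesis using True
        by (simp add: ennreal_1[symmetric] ennreal_leI del: ennreal_1 flip: ennreal_mult)
    qed auto
  qed
  also have "\<dots> = ennreal (exp (- r * T)) *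
      ennreal (exp ((\<Sum>i\<in>I. (r * a i) * x i) + (\<Sum>i\<in>I. (r * a i)\<^sup>2) * N0 / 4))"
    by (subst nn_integral_cmult) (use assms in \<open>auto simp: nn_integral_exp_gvec\<close>)
  also have "\<dots> = ennreal (exp (- r * T + r * (\<Sum>i\<in>I. a i * x i) + r\<^sup>2 * V * N0 / 4))"
    by (simp add: V(1)[symmetric] sum_distrib_left mult.assoc power_mult_distrib ennreal_mult[symmetric]
        flip: exp_add)
  also have "\<dots> \<le> ennreal (exp (- (T - \<rho>)\<^sup>2 / (N0 * V)))"
  proof -
    have "r * (\<Sum>i\<in>I. a i * x i) \<le> r * \<rho>" using r \<rho> by (intro mult_left_mono)
    moreover have "- r * T + r * \<rho> + r\<^sup>2 * V * N0 / 4 = - (T - \<rho>)\<^sup>2 / (N0 * V)"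
      using assms by (simp add: r_def field_simps power2_eq_square)
    ultimately show ?thesis by (intro ennreal_leI) simp
  qed
  finally show ?thesis by (simp add: emeasure_eq_measure)
qed

text \<open>Split at log-likelihood ratio \<open>v\<close>. Below it, dP/dQ is at most
  \<open>exp v\<close>. Above it, dP/dQ is at most \<open>exp (- s * v)\<close> times its own power
  1 + s, whose integral under the idle law Q is explicit.\<close>

lemma gvec_change_of_measure:
  assumes "N0 > 0" "finite I" "s \<ge> 0" and G: "G \<in> sets (gvec N0 I x)"
    and K: "(\<Sum>i\<in>I. (x i)\<^sup>2) \<le> K"
  shows "measure (gvec N0 I x) G \<le>
    exp v * measure (gvec N0 I (\<lambda>_. 0)) G + exp (- s * v + s * (1 + s) * K / N0)"
proof -
  let ?Q = "gvec N0 I (\<lambda>_. 0)" and ?P = "gvec N0 I x"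
  interpret P: prob_space ?P by (rule prob_space_gvec) fact
  interpret Q: prob_space ?Q by (rule prob_space_gvec) fact
  define K' where "K' = (\<Sum>i\<in>I. (x i)\<^sup>2)"
  \<comment> \<open>Chosen so that \<open>exp (c + (\<Sum>i\<in>I. a i * y i))\<close> is
    \<open>exp (- s * v)\<close> times the power 1 + s of the likelihood ratio; the fact
    \<open>u\<close> below records this.\<close>
  define a where "a i = 2 * (1 + s) * x i / N0" for i
  define c where "c = - s * v - (1 + s) * K' / N0"
  have G': "G \<in> sets ?Q" using G by (simp add: sets_gvec)
  let ?u = "\<lambda>y. \<Sum>i\<in>I. (2 * x i * y i - (x i)\<^sup>2) / N0"
  have u: "(1 + s) * ?u y - s * v = c + (\<Sum>i\<in>I. a i * y i)" for y
    using assms(1) by (simp add: a_def c_def K'_def sum_subtractf sum_distrib_left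
        sum_divide_distrib diff_divide_distrib algebra_simps)
  have "emeasure ?P G = emeasure (density ?Q (\<lambda>y. ennreal (exp (?u y)))) G"
    by (subst gvec_density_zero[OF assms(1,2)]) simp
  also have "\<dots> = (\<integral>\<^sup>+ y. ennreal (exp (?u y)) * indicator G y \<partial>?Q)"
    by (rule emeasure_density) (use G' in auto)
  also have "\<dots> \<le> (\<integral>\<^sup>+ y. ennreal (exp v) * indicator G y +
      ennreal (exp c) * ennreal (exp (\<Sum>i\<in>I. a i * y i)) \<partial>?Q)"
  proof (rule nn_integral_mono)
    fix y
    have "exp (?u y) \<le> exp v + exp c * exp (\<Sum>i\<in>I. a i * y i)"
    proof (cases "?u y \<le> v")
      case True
      then have "exp (?u y) \<le> exp v" by simp
      then show ?thesis by (smt (verit) exp_gt_zero mult_pos_pos)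
    next
      case False
      then have "s * v \<le> s * ?u y" using assms(3) by (intro mult_left_mono) auto
      then have "?u y \<le> (1 + s) * ?u y - s * v" by (simp add: distrib_right)
      then have "exp (?u y) \<le> exp c * exp (\<Sum>i\<in>I. a i * y i)"
        unfolding u by (simp flip: exp_add)
      then show ?thesis by (smt (verit) exp_gt_zero)
    qed
    then show "ennreal (exp (?u y)) * indicator G y \<le> ennreal (exp v) * indicator G y +
        ennreal (exp c) * ennreal (exp (\<Sum>i\<in>I. a i * y i))"
      by (auto simp: indicator_def simp flip: ennreal_mult ennreal_plus intro!: ennreal_leI)
  qed
  also have "\<dots> = ennreal (exp v) * emeasure ?Q G + ennreal (exp c) *
      ennreal (exp ((\<Sum>i\<in>I. (a i)\<^sup>2) * N0 / 4))"
    using G' assms by (subst nn_integral_add) (auto simp: nn_integral_cmult nn_integral_exp_gvec)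
  also have "\<dots> = ennreal (exp v * measure ?Q G + exp (c + (\<Sum>i\<in>I. (a i)\<^sup>2) * N0 / 4))"
    by (simp add: Q.emeasure_eq_measure ennreal_mult exp_add)
  finally have "measure ?P G \<le> exp v * measure ?Q G + exp (c + (\<Sum>i\<in>I. (a i)\<^sup>2) * N0 / 4)"
    by (simp add: P.emeasure_eq_measure del: ennreal_plus flip: ennreal_plus)
  moreover have "c + (\<Sum>i\<in>I. (a i)\<^sup>2) * N0 / 4 = - s * v + s * (1 + s) * K' / N0"
  proof -
    have "(\<Sum>i\<in>I. (a i)\<^sup>2) = 4 * (1 + s)\<^sup>2 / N0\<^sup>2 * K'"
      unfolding K'_def sum_distrib_left a_def
      by (intro sum.cong refl) (use assms(1) in \<open>simp add: field_simps power2_eq_square\<close>)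
    then show ?thesis
      using assms(1) by (simp add: c_def field_simps power2_eq_square)
  qed
  moreover have "s * (1 + s) * K' / N0 \<le> s * (1 + s) * K / N0"
    using K assms by (intro divide_right_mono mult_left_mono) (auto simp: K'_def)
  ultimately show ?thesis by (smt (verit) exp_le_cancel_iff)
qed

text \<open>The event is the preimage of an event on the marginal over \<open>J\<close>, and that
  marginal involves only the means on \<open>J\<close>. The converse applies this to decisions taken
  before the message arrives, when only noise has been seen.\<close>

lemma measure_gvec_determined:
  assumes "N0 > 0" "finite I" "J \<subseteq> I" and F: "F \<in> sets (PiM I (\<lambda>_. borel))"
    and det: "\<And>y y'. \<lbrakk>y \<in> space (PiM I (\<lambda>_. borel :: real measure));
        y' \<in> space (PiM I (\<lambda>_. borel :: real measure)); \<forall>i\<in>J. y i = y' i; y \<in> F\<rbrakk> \<Longrightarrow> y' \<in> F"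
    and x: "\<And>i. i \<in> J \<Longrightarrow> x i = x' i"
  shows "measure (gvec N0 I x) F = measure (gvec N0 I x') F"
proof -
  \<comment> \<open>Extension by zero, an arbitrary default, from \<open>J\<close> to
    \<open>I\<close>. Pulling \<open>F\<close> back along \<open>e\<close> gives a measurable set
    \<open>F'\<close> on the smaller product; \<open>det\<close> shows that it represents
    \<open>F\<close>.\<close>
  define e :: "('a \<Rightarrow> real) \<Rightarrow> 'a \<Rightarrow> real" where "e z = (\<lambda>i\<in>I. if i \<in> J then z i else 0)" for z
  have e [measurable]: "e \<in> measurable (PiM J (\<lambda>_. borel)) (PiM I (\<lambda>_. borel))"
    unfolding e_def
  proof (rule measurable_restrict)
    fix i assume "i \<in> I"
    show "(\<lambda>z :: 'a \<Rightarrow> real. if i \<in> J then z i else 0) \<in> borel_measurable (PiM J (\<lambda>_. borel))"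
      by (cases "i \<in> J") auto
  qed
  define F' where "F' = e -` F \<inter> space (PiM J (\<lambda>_. borel))"
  have F': "F' \<in> sets (PiM J (\<lambda>_. borel))"
    unfolding F'_def using F by (rule measurable_sets[OF e])
  have FF': "(\<lambda>y. restrict y J) -` F' \<inter> space (PiM I (\<lambda>_. borel)) = F"
  proof -
    have "e (restrict y J) \<in> F \<longleftrightarrow> y \<in> F" if "y \<in> space (PiM I (\<lambda>_. borel))" for y
    proof -
      have "e (restrict y J) \<in> space (PiM I (\<lambda>_. borel :: real measure))"
        by (auto simp: e_def space_PiM)
      moreover have "\<forall>i\<in>J. e (restrict y J) i = y i" using assms(3) by (auto simp: e_def)
      ultimately show ?thesis using det that by metis
    qed
    moreover have "y \<in> space (PiM I (\<lambda>_. borel))" if "y \<in> F" for y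
      using sets.sets_into_space[OF F] that by auto
    ultimately show ?thesis by (auto simp: F'_def space_PiM)
  qed
  have "measure (gvec N0 I z) F = measure (gvec N0 J z) F'" for z
  proof -
    interpret product_prob_space "\<lambda>i. gauss N0 (z i)" I
      by (rule product_prob_space_gauss) fact
    have "measure (gvec N0 J z) F' = measure (distr (gvec N0 I z) (gvec N0 J z) (\<lambda>y. restrict y J)) F'"
      unfolding gvec_def using assms(2,3)
      by (subst distr_PiM_restrict_finite) (auto intro: finite_subset)
    also have "\<dots> = measure (gvec N0 I z) ((\<lambda>y. restrict y J) -` F' \<inter> space (gvec N0 I z))"
      using F' assms(3)
      by (intro measure_distr) (auto simp: gvec_def sets_gvec[unfolded gvec_def]
          intro!: measurable_restrict_subset)
    finally show ?thesis using FF' by (simp add: space_gvec)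
  qed
  moreover have "gvec N0 J x = gvec N0 J x'"
    unfolding gvec_def by (rule PiM_cong) (auto simp: x)
  ultimately show ?thesis by simp
qed

lemma (in prob_space) sum_prob_disjoint_le_1:
  assumes "finite S" "\<And>i. i \<in> S \<Longrightarrow> E i \<in> events" "disjoint_family_on E S"
  shows "(\<Sum>i\<in>S. prob (E i)) \<le> 1"
proof -
  have "(\<Sum>i\<in>S. prob (E i)) = prob (\<Union>i\<in>S. E i)"
    by (rule finite_measure_finite_Union[symmetric]) (use assms in auto)
  then show ?thesis by simp
qed

subsection \<open>Transmitted signals\<close>

definition signal :: "ascheme \<Rightarrow> nat \<Rightarrow> nat \<Rightarrow> nat \<Rightarrow> real" where
  "signal C s m i = (if s \<le> i \<and> i \<le> s + len C - 1 then cw C m (i - s + 1) else 0)"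

lemma out_meas_eq: "out_meas N0 A C t m = gvec N0 {1..horizon A C} (signal C (start C t m) m)"
  unfolding out_meas_def gvec_def signal_def by (rule PiM_cong) auto

text \<open>A start no later than \<open>A\<close> keeps the whole codeword inside the horizon, so
  nothing is truncated. With \<open>m = m'\<close> this is the energy, otherwise the correlation of
  two codewords.\<close>

lemma sum_signal_mult:
  assumes "len C \<ge> 1" "1 \<le> s" "s \<le> A"
  shows "(\<Sum>i\<in>{1..horizon A C}. signal C s m i * signal C s m' i) =
    (\<Sum>j=1..len C. cw C m j * cw C m' j)"
proof -
  have "(\<Sum>i\<in>{1..horizon A C}. signal C s m i * signal C s m' i) =
      (\<Sum>i\<in>{s..s + len C - 1}. signal C s m i * signal C s m' i)"
    using assms by (intro sum.mono_neutral_right) (auto simp: horizon_def signal_def)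
  also have "\<dots> = (\<Sum>j=1..len C. cw C m j * cw C m' j)"
    by (rule sum.reindex_bij_witness[of _ "\<lambda>j. j + s - 1" "\<lambda>i. i - s + 1"])
      (use assms in \<open>auto simp: signal_def\<close>)
  finally show ?thesis .
qed

subsection \<open>Converse\<close>

lemma energy_le_cost: "m < M \<Longrightarrow> (\<Sum>i=1..len C. (cw C m i)\<^sup>2) \<le> cost M C"
  unfolding cost_def by (rule Max_ge) auto

text \<open>The non-asymptotic converse. A stop by time t + d means a wrong decision, the decision m
  before t (\<open>F\<close>), or the decision m in the window from t to t + d (\<open>G\<close>).
  The three cases are summed over all pairs (t, m); the threshold \<open>v\<close> and the exponent
  \<open>s\<close> stay free.\<close>

lemma converse_one_shot:
  assumes "N0 > 0" "A \<ge> 1" "M \<ge> 1" "s \<ge> 0" and valid: "valid_scheme A M C"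
    and err: "err_prob N0 A M C \<le> eps"
    and del: "\<And>m. m < M \<Longrightarrow> delay_prob N0 A C m d \<ge> 1 - eps"
  shows "1 - 2 * eps - 1 / real M - exp v * (real d + 1) / (real A * real M)
    \<le> exp (- s * v + s * (1 + s) * cost M C / N0)"
proof -
  define I where "I = {1..horizon A C}"
  define \<Omega> where "\<Omega> = space (obs A C)"
  let ?Q = "gvec N0 I (\<lambda>_. 0)" and ?P = "out_meas N0 A C"
  define W where "W = exp (- s * v + s * (1 + s) * cost M C / N0)"
  define G where "G t m = {y \<in> \<Omega>. dec C y = m \<and> t \<le> stop C y \<and> stop C y \<le> t + d}" for t m
  define F where "F t m = {y \<in> \<Omega>. dec C y = m \<and> stop C y < t}" for t m
  define S where "S n = {y \<in> \<Omega>. stop C y = n}" for n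
  have obs: "obs A C = PiM I (\<lambda>_. borel)" by (simp add: obs_def I_def)
  have P: "?P t m = gvec N0 I (signal C (start C t m) m)" for t m
    by (simp add: out_meas_eq I_def)
  have spaceP: "space (?P t m) = \<Omega>" and setsP: "sets (?P t m) = sets (obs A C)" for t m
    by (simp_all add: P space_gvec sets_gvec \<Omega>_def obs)
  have spaceQ: "space ?Q = \<Omega>" and setsQ: "sets ?Q = sets (obs A C)"
    by (simp_all add: space_gvec sets_gvec \<Omega>_def obs)
  interpret Q: prob_space ?Q by (rule prob_space_gvec) fact
  have [measurable]: "dec C \<in> measurable (obs A C) (count_space UNIV)"
    and S: "\<And>n. S n \<in> sets (obs A C)"
    using valid by (auto simp: valid_scheme_def S_def \<Omega>_def)
  have [measurable]: "stop C \<in> measurable (obs A C) (count_space UNIV)"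
    unfolding measurable_count_space_eq2_countable using S
    by (auto simp: S_def \<Omega>_def vimage_def Int_def conj_commute)
  have G: "G t m \<in> sets (obs A C)" and F: "F t m \<in> sets (obs A C)"
    and E: "{y \<in> \<Omega>. dec C y \<noteq> m} \<in> sets (obs A C)" for t m
    unfolding G_def F_def \<Omega>_def by measurable
  have start: "t \<le> start C t m" "start C t m \<le> A" if "t \<in> {1..A}" "m < M" for t m
    using valid that by (auto simp: valid_scheme_def)
  have causal_stop: "stop C y = n \<longleftrightarrow> stop C y' = n"
    if "y \<in> space (obs A C)" "y' \<in> space (obs A C)" "\<forall>i\<in>{1..n}. y i = y' i" for y y' n
    using valid that unfolding valid_scheme_def by blast
  have causal_dec: "dec C y = dec C y'"
    if "y \<in> space (obs A C)" "y' \<in> space (obs A C)" "\<forall>i\<in>{1..stop C y}. y i = y' i" for y y'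
    using valid that unfolding valid_scheme_def by blast
  have len: "len C \<ge> 1" using valid by (simp add: valid_scheme_def)

  \<comment> \<open>Causality makes \<open>F t m\<close> an event of the first t - 1 outputs, and
    these are idle because no codeword starts before t.\<close>
  have PF: "measure (?P t m) (F t m) = measure ?Q (F t m)" if tm: "t \<in> {1..A}" "m < M" for t m
    unfolding P
  proof (rule measure_gvec_determined[where J = "{1..<t}"])
    show "{1..<t} \<subseteq> I" using tm len by (auto simp: I_def horizon_def)
    show "signal C (start C t m) m i = 0" if "i \<in> {1..<t}" for i
      using start[OF tm] that by (simp add: signal_def)
    fix y y' assume y: "y \<in> space (PiM I (\<lambda>_. borel :: real measure))"
      "y' \<in> space (PiM I (\<lambda>_. borel :: real measure))" "\<forall>i\<in>{1..<t}. y i = y' i" "y \<in> F t m"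
    have yo: "y \<in> space (obs A C)" "y' \<in> space (obs A C)" using y by (auto simp: obs)
    have "stop C y < t" "dec C y = m" using y by (auto simp: F_def)
    then have agree: "\<forall>i\<in>{1..stop C y}. y i = y' i" using y by auto
    have "stop C y' = stop C y" using causal_stop[OF yo agree] by simp
    moreover have "dec C y' = dec C y" using causal_dec[OF yo agree] by simp
    ultimately show "y' \<in> F t m" using \<open>stop C y < t\<close> \<open>dec C y = m\<close> yo by (simp add: F_def \<Omega>_def)
  next
    show "F t m \<in> sets (PiM I (\<lambda>_. borel))" using F[of t m] by (simp add: obs)
  qed (simp_all add: I_def \<open>N0 > 0\<close>)

  have step: "measure (?P t m) {y \<in> space (?P t m). int (stop C y) - int t \<le> int d} \<le>
      measure (?P t m) {y \<in> space (?P t m). dec C y \<noteq> m} + measure ?Q (F t m) +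
      exp v * measure ?Q (G t m) + W" if tm: "t \<in> {1..A}" "m < M" for t m
  proof -
    interpret P: prob_space "?P t m" unfolding P by (rule prob_space_gvec) fact
    let ?E = "{y \<in> space (?P t m). dec C y \<noteq> m}"
    have EFG: "?E \<in> P.events" "F t m \<in> P.events" "G t m \<in> P.events"
      using E[of m] F[of t m] G[of t m] by (simp_all only: setsP spaceP)
    \<comment> \<open>The delay is a signed difference, so stops before t count as punctual;
      \<open>F\<close> accounts for them.\<close>
    have "{y \<in> space (?P t m). int (stop C y) - int t \<le> int d} \<subseteq> (?E \<union> F t m) \<union> G t m"
      unfolding F_def G_def spaceP by auto
    then have "P.prob {y \<in> space (?P t m). int (stop C y) - int t \<le> int d} \<le>
        P.prob ((?E \<union> F t m) \<union> G t m)"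
      by (rule P.finite_measure_mono) (intro sets.Un EFG)
    also have "\<dots> \<le> P.prob (?E \<union> F t m) + P.prob (G t m)"
      by (intro measure_Un_le sets.Un EFG)
    also have "P.prob (?E \<union> F t m) \<le> P.prob ?E + P.prob (F t m)"
      by (intro measure_Un_le EFG)
    also have "P.prob (G t m) \<le> exp v * measure ?Q (G t m) + W"
      unfolding P W_def
    proof (rule gvec_change_of_measure)
      show "(\<Sum>i\<in>I. (signal C (start C t m) m i)\<^sup>2) \<le> cost M C"
        using sum_signal_mult[OF len, of "start C t m" A m m] start[OF tm] tm energy_le_cost[of m M C]
        by (auto simp: I_def power2_eq_square)
      show "G t m \<in> sets (gvec N0 I (signal C (start C t m) m))"
        using G[of t m] by (simp add: sets_gvec obs)
    qed (simp_all add: I_def \<open>N0 > 0\<close> \<open>s \<ge> 0\<close>)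
    finally show ?thesis using PF[OF tm] by simp
  qed

  \<comment> \<open>For fixed t the decision separates the events. Summed over t they contribute at
    most A out of A * M, the source of the term 1 / M.\<close>
  have sumF: "(\<Sum>m<M. measure ?Q (F t m)) \<le> 1" for t
    by (rule Q.sum_prob_disjoint_le_1) (use F in \<open>auto simp: setsQ F_def disjoint_family_on_def\<close>)
  \<comment> \<open>For fixed t, the disjoint \<open>G t m\<close> lie in the d + 1 events that the
    stop occurs at t + j. After exchanging the sums, each offset j contributes disjoint events over
    t, hence at most 1.\<close>
  have "(\<Sum>m<M. measure ?Q (G t m)) \<le> (\<Sum>j\<le>d. measure ?Q (S (t + j)))" for t
  proof -
    have "(\<Sum>m<M. measure ?Q (G t m)) = measure ?Q (\<Union>m<M. G t m)"
      by (rule Q.finite_measure_finite_Union[symmetric])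
        (use G in \<open>auto simp: setsQ G_def disjoint_family_on_def\<close>)
    also have "\<dots> \<le> measure ?Q (\<Union>j\<le>d. S (t + j))"
    proof (rule Q.finite_measure_mono)
      show "(\<Union>m<M. G t m) \<subseteq> (\<Union>j\<le>d. S (t + j))"
      proof
        fix y assume "y \<in> (\<Union>m<M. G t m)"
        then have "y \<in> S (t + (stop C y - t))" "stop C y - t \<le> d" by (auto simp: G_def S_def)
        then show "y \<in> (\<Union>j\<le>d. S (t + j))" by blast
      qed
    qed (use S in \<open>auto simp: setsQ\<close>)
    also have "\<dots> \<le> (\<Sum>j\<le>d. measure ?Q (S (t + j)))"
      by (rule measure_UNION_le) (use S in \<open>auto simp: setsQ\<close>)
    finally show ?thesis .
  qed
  then have "(\<Sum>t=1..A. \<Sum>m<M. measure ?Q (G t m)) \<le> (\<Sum>t=1..A. \<Sum>j\<le>d. measure ?Q (S (t + j)))"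
    by (intro sum_mono)
  also have "\<dots> = (\<Sum>j\<le>d. \<Sum>t=1..A. measure ?Q (S (t + j)))"
    by (rule sum.swap)
  also have "\<dots> \<le> (\<Sum>j\<le>d. 1)"
    by (intro sum_mono Q.sum_prob_disjoint_le_1)
      (use S in \<open>auto simp: setsQ S_def disjoint_family_on_def\<close>)
  finally have sumG: "(\<Sum>t=1..A. \<Sum>m<M. measure ?Q (G t m)) \<le> real d + 1" by simp

  have "real A * real M * (1 - eps) = (\<Sum>m<M. real A * (1 - eps))" by simp
  also have "\<dots> \<le> (\<Sum>m<M. \<Sum>t=1..A. measure (?P t m)
      {y \<in> space (?P t m). int (stop C y) - int t \<le> int d})"
    using del assms(2) by (intro sum_mono) (auto simp: delay_prob_def field_simps)
  also have "\<dots> \<le> (\<Sum>m<M. \<Sum>t=1..A. measure (?P t m) {y \<in> space (?P t m). dec C y \<noteq> m} +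
      measure ?Q (F t m) + exp v * measure ?Q (G t m) + W)"
    using step by (intro sum_mono) auto
  also have "\<dots> = (\<Sum>m<M. \<Sum>t=1..A. measure (?P t m) {y \<in> space (?P t m). dec C y \<noteq> m}) +
      (\<Sum>t=1..A. \<Sum>m<M. measure ?Q (F t m)) +
      exp v * (\<Sum>t=1..A. \<Sum>m<M. measure ?Q (G t m)) + real A * real M * W"
    unfolding sum.swap[of _ "{..<M}" "{1..A}"] by (simp only: sum.distrib flip: sum_distrib_left) simp
  also have "(\<Sum>m<M. \<Sum>t=1..A. measure (?P t m) {y \<in> space (?P t m). dec C y \<noteq> m}) \<le>
      (\<Sum>m<M. real A * eps)"
  proof (rule sum_mono)
    fix m assume "m \<in> {..<M}"
    then have "(\<Sum>t=1..A. measure (?P t m) {y \<in> space (?P t m). dec C y \<noteq> m}) / real A \<le> err_prob N0 A M C"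
      unfolding err_prob_def by (intro Max_ge) auto
    then have "(\<Sum>t=1..A. measure (?P t m) {y \<in> space (?P t m). dec C y \<noteq> m}) / real A \<le> eps"
      using err by linarith
    with assms(2) show "(\<Sum>t=1..A. measure (?P t m) {y \<in> space (?P t m). dec C y \<noteq> m}) \<le> real A * eps"
      by (simp add: field_simps)
  qed
  also have "(\<Sum>t=1..A. \<Sum>m<M. measure ?Q (F t m)) \<le> (\<Sum>t=1..A. 1)"
    by (rule sum_mono) (rule sumF)
  also have "exp v * (\<Sum>t=1..A. \<Sum>m<M. measure ?Q (G t m)) \<le> exp v * (real d + 1)"
    using sumG by (intro mult_left_mono) auto
  finally have "real A * real M * (1 - eps) \<le> real A * real M * eps + real A + exp v * (real d + 1) +
      real A * real M * W" by (simp add: mult_ac)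
  moreover have "real A * real M * (1 - 2 * eps - 1 / real M - exp v * (real d + 1) / (real A * real M)) =
      real A * real M * (1 - eps) - real A * real M * eps - real A - exp v * (real d + 1)"
    using assms(2,3) by (simp add: field_simps)
  ultimately have "real A * real M * (1 - 2 * eps - 1 / real M - exp v * (real d + 1) / (real A * real M))
      \<le> real A * real M * W" by linarith
  then show ?thesis unfolding W_def[symmetric]
    by (subst (asm) mult_le_cancel_left_pos) (use assms(2,3) in auto)
qed

section \<open>Asymptotic form of the converse\<close>

text \<open>The minimum in \<open>delay\<close> is attained once some d qualifies. The horizon does:
  every stop is bounded by it, and \<open>eps\<close> is nonnegative since it dominates an error
  probability.\<close>

lemma delay_attained:
  assumes "N0 > 0" "A \<ge> 1" "M \<ge> 1" and valid: "valid_scheme A M C"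
    and err: "err_prob N0 A M C \<le> eps" and "m < M"
  shows "delay_prob N0 A C m (delay N0 A M C eps) \<ge> 1 - eps"
proof -
  have "0 \<le> err_prob N0 A M C"
  proof -
    have "0 \<le> (\<Sum>t=1..A. measure (out_meas N0 A C t 0)
        {y\<in>space (out_meas N0 A C t 0). dec C y \<noteq> 0}) / real A"
      by (intro divide_nonneg_nonneg sum_nonneg) auto
    also have "\<dots> \<le> err_prob N0 A M C"
      unfolding err_prob_def by (rule Max_ge, simp, rule image_eqI[where x = 0]) (use assms(3) in auto)
    finally show ?thesis .
  qed
  moreover have "delay_prob N0 A C m (horizon A C) = 1" for m
  proof -
    have "measure (out_meas N0 A C t m)
        {y\<in>space (out_meas N0 A C t m). int (stop C y) - int t \<le> int (horizon A C)} = 1" for t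
    proof -
      interpret prob_space "out_meas N0 A C t m"
        unfolding out_meas_eq by (rule prob_space_gvec) fact
      have "{y\<in>space (out_meas N0 A C t m). int (stop C y) - int t \<le> int (horizon A C)} =
          space (out_meas N0 A C t m)"
        using valid by (force simp: valid_scheme_def out_meas_eq space_gvec obs_def)
      then show ?thesis by (simp add: prob_space)
    qed
    then show ?thesis using assms(2) by (simp add: delay_prob_def)
  qed
  ultimately have "\<forall>m<M. delay_prob N0 A C m (horizon A C) \<ge> 1 - eps" using err by simp
  then have "\<forall>m<M. delay_prob N0 A C m (delay N0 A M C eps) \<ge> 1 - eps"
    unfolding delay_def by (rule LeastI)
  then show ?thesis using assms by blast
qed

text \<open>Rounding up a number that is at least 1 costs at most a factor 2.\<close>

lemma asyn_ge_1: "\<beta> \<ge> 0 \<Longrightarrow> asyn \<beta> B \<ge> 1"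
  and asyn_ge: "2 powr (\<beta> * real B) \<le> real (asyn \<beta> B)"
  and asyn_le: "\<beta> \<ge> 0 \<Longrightarrow> real (asyn \<beta> B) \<le> 2 * 2 powr (\<beta> * real B)"
proof -
  show "2 powr (\<beta> * real B) \<le> real (asyn \<beta> B)"
    unfolding asyn_def by (rule real_nat_ceiling_ge)
  assume "\<beta> \<ge> 0"
  then have 1: "2 powr (\<beta> * real B) \<ge> 1" by (intro ge_one_powr_ge_zero) auto
  then show "asyn \<beta> B \<ge> 1" unfolding asyn_def by linarith
  show "real (asyn \<beta> B) \<le> 2 * 2 powr (\<beta> * real B)" unfolding asyn_def using 1 by linarith
qed

text \<open>One slack \<open>s\<close> serves as change-of-measure exponent, as delay exponent and
  as rate loss. For fixed \<open>s\<close> the one-shot bound becomes an inequality between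
  coefficients of B, with a constant that vanishes after division by B.\<close>

lemma achievable_upper:
  assumes "N0 > 0" "\<beta> \<ge> 0" "achievable N0 \<beta> 0 R" "0 < s" "s < R"
  shows "(1 + \<beta> - s) * ln 2 \<le> (1 + s) / ((R - s) * N0)"
proof -
  obtain C eps where eps: "eps \<longlonglongrightarrow> 0"
    and valid: "\<And>B. valid_scheme (asyn \<beta> B) (2 ^ B) (C B)"
    and err: "\<And>B. err_prob N0 (asyn \<beta> B) (2 ^ B) (C B) \<le> eps B"
    and del: "\<And>e. e > 0 \<Longrightarrow> eventually (\<lambda>B. real (delay N0 (asyn \<beta> B) (2 ^ B) (C B) (eps B))
        \<le> 2 powr ((0 + e) * real B)) sequentially"
    and cost: "\<And>e. e > 0 \<Longrightarrow> eventually (\<lambda>B. (R - e) * cost (2 ^ B) (C B) \<le> real B) sequentially"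
    using assms(3) unfolding achievable_def by blast
  \<comment> \<open>The three losses of the one-shot bound become at most 1/4 each: 2 *
    \<open>eps B\<close> by this choice, 1 / M from B at least 2, and the third by the choice of
    \<open>v\<close>. The left side stays at least 1/4.\<close>
  have "eventually (\<lambda>B. eps B < 1 / 8) sequentially"
    by (rule order_tendstoD(2)[OF eps]) simp
  moreover note del[OF \<open>0 < s\<close>] cost[OF \<open>0 < s\<close>] eventually_ge_at_top[of "2 :: nat"]
  ultimately have "eventually (\<lambda>B. (1 + \<beta> - s) * ln 2 - (1 + s) / ((R - s) * N0)
      \<le> (ln 8 + ln 4 / s) / real B) sequentially"
  proof eventually_elim
    case (elim B)
    define A where "A = asyn \<beta> B"
    define M :: nat where "M = 2 ^ B"
    define d where "d = delay N0 A M (C B) (eps B)"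
    define K where "K = cost M (C B)"
    note defs = A_def[symmetric] M_def[symmetric] d_def[symmetric] K_def[symmetric]
    have A: "A \<ge> 1" "2 powr (\<beta> * real B) \<le> real A"
      unfolding A_def using asyn_ge_1 asyn_ge assms(2) by auto
    have M: "M \<ge> 4" using power_increasing[OF elim(4), of "2::nat"] by (simp add: M_def)
    define v where "v = ln (real A * real M / (4 * (real d + 1)))"
    have v: "exp v = real A * real M / (4 * (real d + 1))"
      unfolding v_def using A M by (subst exp_ln) (auto intro!: divide_pos_pos)
    have "1 - 2 * eps B - 1 / real M - exp v * (real d + 1) / (real A * real M)
        \<le> exp (- s * v + s * (1 + s) * K / N0)"
      unfolding K_def
    proof (rule converse_one_shot)
      show "1 - eps B \<le> delay_prob N0 A (C B) m d" if "m < M" for m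
        unfolding d_def using A M valid[of B] err[of B] that \<open>N0 > 0\<close>
        by (intro delay_attained) (auto simp: defs)
    qed (use A M valid[of B] err[of B] assms in \<open>auto simp: defs\<close>)
    moreover have "exp v * (real d + 1) / (real A * real M) = 1 / 4"
    proof -
      have "real A * real M \<noteq> 0" "real d + 1 \<noteq> 0" using A M by auto
      then show ?thesis unfolding v by simp
    qed
    moreover have "1 / real M \<le> 1 / 4" using M by (simp add: field_simps)
    ultimately have "1 / 4 \<le> exp (- s * v + s * (1 + s) * K / N0)" using elim(1) by linarith
    then have "ln (1 / 4) \<le> ln (exp (- s * v + s * (1 + s) * K / N0))"
      by (intro ln_mono) auto
    then have "ln (1 / 4) \<le> - s * v + s * (1 + s) * K / N0" by simp
    then have "s * v \<le> ln 4 + s * (1 + s) * K / N0" by (simp add: ln_div)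
    also have "\<dots> = s * (ln 4 / s + (1 + s) * K / N0)" using assms by (simp add: distrib_left)
    finally have "s * v \<le> s * (ln 4 / s + (1 + s) * K / N0)" .
    then have "v \<le> ln 4 / s + (1 + s) * K / N0" using assms by simp
    also have "(1 + s) * K / N0 \<le> (1 + s) * (real B / (R - s)) / N0"
      using elim(3) assms by (intro divide_right_mono mult_left_mono) (auto simp: defs field_simps)
    also have "(1 + s) * (real B / (R - s)) / N0 = (1 + s) / ((R - s) * N0) * real B" by simp
    finally have "v \<le> ln 4 / s + (1 + s) / ((R - s) * N0) * real B" by simp
    \<comment> \<open>The 8 collects the 4 in \<open>v\<close> and the 2 from bounding d + 1 by
      twice \<open>2 powr (s * real B)\<close>.\<close>
    moreover have "(1 + \<beta> - s) * ln 2 * real B - ln 8 \<le> v"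
    proof -
      have "1 \<le> 2 powr (s * real B)" using assms by (intro ge_one_powr_ge_zero) auto
      then have d: "real d + 1 \<le> 2 * 2 powr (s * real B)" using elim(2) by (simp add: defs)
      have "(1 + \<beta> - s) * ln 2 * real B - ln 8 = ln (2 powr (\<beta> * real B) * 2 powr real B / (4 * (2 * 2 powr (s * real B))))"
        by (simp add: ln_div ln_mult ln_powr algebra_simps)
      also have "\<dots> \<le> v"
        unfolding v_def using A M d by (intro ln_mono frac_le mult_mono)
          (auto simp: M_def powr_realpow intro!: divide_pos_pos)
      finally show ?thesis .
    qed
    ultimately have "((1 + \<beta> - s) * ln 2 - (1 + s) / ((R - s) * N0)) * real B \<le> ln 8 + ln 4 / s"
      by (simp add: left_diff_distrib)
    then show ?case using elim(4) by (simp add: field_simps)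
  qed
  moreover have "(\<lambda>B. (ln 8 + ln 4 / s) / real B) \<longlonglongrightarrow> 0" by real_asymp
  ultimately have "(1 + \<beta> - s) * ln 2 - (1 + s) / ((R - s) * N0) \<le> 0"
    by (intro tendsto_lowerbound[where F = sequentially]) auto
  then show ?thesis by simp
qed

text \<open>Let \<open>s\<close> tend to 0 from the right in the previous bound, which requires R >
  0; for other R the nonnegative right side suffices.\<close>

lemma achievable_le_capacity:
  assumes "N0 > 0" "\<beta> \<ge> 0" "achievable N0 \<beta> 0 R"
  shows "R \<le> 1 / (1 + \<beta>) * (log 2 (exp 1) / N0)"
proof (cases "R > 0")
  case True
  have "eventually (\<lambda>s. s \<in> {0<..<R}) (at_right 0)"
    using True by (rule eventually_at_right_real)
  then have "eventually (\<lambda>s. (1 + \<beta> - s) * ln 2 \<le> (1 + s) / ((R - s) * N0)) (at_right 0)"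
    by eventually_elim (use achievable_upper[OF assms] in auto)
  moreover have "((\<lambda>s. (1 + \<beta> - s) * ln 2) \<longlongrightarrow> (1 + \<beta> - 0) * ln 2) (at_right 0)"
    by (intro tendsto_intros)
  moreover have "((\<lambda>s. (1 + s) / ((R - s) * N0)) \<longlongrightarrow> (1 + 0) / ((R - 0) * N0)) (at_right 0)"
    using True assms by (intro tendsto_intros) auto
  ultimately have "(1 + \<beta> - 0) * ln 2 \<le> (1 + 0) / ((R - 0) * N0)"
    by (intro tendsto_le[of "at_right 0"]) auto
  then have "R * ((1 + \<beta>) * ln 2 * N0) \<le> 1" using True assms by (simp add: field_simps)
  then have "R \<le> 1 / ((1 + \<beta>) * ln 2 * N0)" using assms by (subst pos_le_divide_eq) auto
  then show ?thesis by (simp add: log_def)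
next
  case False
  have "0 \<le> 1 / (1 + \<beta>) * (log 2 (exp 1) / N0)" using assms by (simp add: log_def)
  with False show ?thesis by linarith
qed

subsection \<open>Pulse position codebook\<close>

text \<open>Union bound over the sets \<open>T\<close> of exactly \<open>a\<close> places of
  agreement: at most \<open>2 ^ n\<close> such sets, each leaving n - a coordinates free.\<close>

lemma card_agreeing_le:
  assumes "a \<le> n" "f \<in> {..<n} \<rightarrow>\<^sub>E {..<q}"
  shows "card {g \<in> {..<n} \<rightarrow>\<^sub>E {..<q}. a \<le> card {b. b < n \<and> f b = g b}} \<le> 2 ^ n * q ^ (n - a)"
proof -
  let ?TT = "{T. T \<subseteq> {..<n} \<and> card T = a}"
  let ?X = "\<lambda>T. \<Pi>\<^sub>E b\<in>{..<n}. if b \<in> T then {f b} else {..<q}"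
  have fin: "finite ?TT" by (rule finite_subset[of _ "Pow {..<n}"]) auto
  have X: "card (?X T) = q ^ (n - a)" if T: "T \<in> ?TT" for T
  proof -
    have "card (?X T) = (\<Prod>b<n. if b \<in> T then 1 else q)"
      by (subst card_PiE) (auto intro!: prod.cong)
    also have "\<dots> = (\<Prod>b\<in>{..<n} - T. q)"
      by (rule prod.mono_neutral_cong_right) auto
    also have "\<dots> = q ^ (n - a)" using T by (simp add: card_Diff_subset finite_subset[of T "{..<n}"])
    finally show ?thesis .
  qed
  have "{g \<in> {..<n} \<rightarrow>\<^sub>E {..<q}. a \<le> card {b. b < n \<and> f b = g b}} \<subseteq> (\<Union>T\<in>?TT. ?X T)"
  proof safe
    fix g assume g: "g \<in> {..<n} \<rightarrow>\<^sub>E {..<q}" "a \<le> card {b. b < n \<and> f b = g b}"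
    obtain T where "T \<subseteq> {b. b < n \<and> f b = g b}" "card T = a"
      using obtain_subset_with_card_n[OF g(2)] by metis
    then have "T \<in> ?TT" "g \<in> ?X T" using g(1) by (auto simp: PiE_iff)
    then show "g \<in> (\<Union>T\<in>?TT. ?X T)" by blast
  qed
  then have "card {g \<in> {..<n} \<rightarrow>\<^sub>E {..<q}. a \<le> card {b. b < n \<and> f b = g b}} \<le> card (\<Union>T\<in>?TT. ?X T)"
    by (rule card_mono[rotated]) (auto intro!: fin finite_PiE)
  also have "\<dots> \<le> (\<Sum>T\<in>?TT. card (?X T))" by (rule card_UN_le) (rule fin)
  also have "\<dots> = card ?TT * q ^ (n - a)" by (simp add: X)
  also have "\<dots> \<le> 2 ^ n * q ^ (n - a)"
    using card_mono[of "Pow {..<n}" ?TT] by (intro mult_right_mono) (auto simp: card_Pow)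
  finally show ?thesis .
qed

text \<open>A Gilbert-type argument: the K words already chosen exclude at most
  \<open>K * 2 ^ n * q ^ (n - a)\<close> words, fewer than \<open>q ^ n\<close>, so another word can
  be added.\<close>

lemma greedy_code:
  assumes "a \<le> n" "q > 0" "K * 2 ^ n \<le> q ^ a"
  shows "\<exists>S \<subseteq> {..<n} \<rightarrow>\<^sub>E {..<q}. card S = K \<and> finite S \<and>
    (\<forall>f\<in>S. \<forall>g\<in>S. f \<noteq> g \<longrightarrow> card {b. b < n \<and> f b = g b} < a)"
  using assms(3)
proof (induction K)
  case 0
  then show ?case by (intro exI[of _ "{}"]) auto
next
  case (Suc K)
  let ?X = "{..<n} \<rightarrow>\<^sub>E {..<q}"
  obtain S where S: "S \<subseteq> ?X" "card S = K" "finite S"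
    "\<And>f g. \<lbrakk>f \<in> S; g \<in> S; f \<noteq> g\<rbrakk> \<Longrightarrow> card {b. b < n \<and> f b = g b} < a"
    using Suc by auto
  let ?D = "\<Union>f\<in>S. {g \<in> ?X. a \<le> card {b. b < n \<and> f b = g b}}"
  have "card ?D \<le> (\<Sum>f\<in>S. card {g \<in> ?X. a \<le> card {b. b < n \<and> f b = g b}})"
    by (rule card_UN_le) (rule S)
  also have "\<dots> \<le> (\<Sum>f\<in>S. 2 ^ n * q ^ (n - a))"
    using S(1) by (intro sum_mono card_agreeing_le assms(1)) auto
  also have "\<dots> = K * 2 ^ n * q ^ (n - a)" by (simp add: S)
  also have "\<dots> < Suc K * 2 ^ n * q ^ (n - a)" using assms(2) by simp
  also have "\<dots> \<le> q ^ a * q ^ (n - a)" using Suc.prems by (intro mult_right_mono) auto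
  also have "\<dots> = card ?X" using assms(1) by (simp add: card_PiE flip: power_add)
  finally have "\<not> ?X \<subseteq> ?D"
    using card_mono[of ?D ?X] S(3) by (auto simp: finite_PiE)
  then obtain g where g: "g \<in> ?X" "g \<notin> ?D" by blast
  have far: "card {b. b < n \<and> f b = g b} < a" if "f \<in> S" for f using g that by fastforce
  \<comment> \<open>A word agrees with itself in all n places, and n is at least \<open>a\<close>;
    hence the new word is indeed new.\<close>
  have "g \<notin> S"
  proof
    assume "g \<in> S"
    from far[OF this] assms(1) show False by simp
  qed
  moreover have "card {b. b < n \<and> g b = f b} < a" if "f \<in> S" for f
    using far[OF that] by (simp add: eq_commute)
  ultimately show ?case using S g far by (intro exI[of _ "insert g S"]) auto
qed

text \<open>The codeword has l * (B + 1) frames of \<open>2 ^ (l + 1)\<close> slots, with one pulse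
  of energy \<alpha> in each. Inner products count common pulse positions, so correlation over
  energy is at most 1 / l, while for fixed l the length is linear in B.\<close>

lemma ppm_codebook:
  fixes \<alpha> :: real and l B :: nat
  assumes "l \<ge> 1" "\<alpha> \<ge> 0"
  defines "N \<equiv> l * (B + 1) * 2 ^ (l + 1)"
  shows "\<exists>c :: nat \<Rightarrow> nat \<Rightarrow> real. (\<forall>m<2 ^ B. (\<Sum>j=1..N. (c m j)\<^sup>2) = \<alpha> * (l * (B + 1))) \<and>
    (\<forall>m<2 ^ B. \<forall>m'<2 ^ B. m \<noteq> m' \<longrightarrow> (\<Sum>j=1..N. c m j * c m' j) \<le> \<alpha> * (B + 1))"
proof -
  define n where "n = l * (B + 1)"
  define q :: nat where "q = 2 ^ (l + 1)"
  have N: "N = n * q" by (simp add: N_def n_def q_def)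
  \<comment> \<open>The counting condition for the greedy choice with \<open>a = B + 1\<close>; in
    exponents, B + l * (B + 1) is at most (l + 1) * (B + 1).\<close>
  have "2 ^ B * 2 ^ n \<le> q ^ (B + 1)"
  proof -
    have "(2::nat) ^ B * 2 ^ n = 2 ^ (B + n)" by (simp add: power_add)
    also have "\<dots> \<le> 2 ^ ((l + 1) * (B + 1))" by (rule power_increasing) (auto simp: n_def)
    also have "\<dots> = q ^ (B + 1)" unfolding q_def by (rule power_mult)
    finally show ?thesis .
  qed
  moreover have "q > 0" by (simp add: q_def)
  moreover have "B + 1 \<le> n" unfolding n_def using assms(1) by (metis mult_le_mono1 nat_mult_1)
  ultimately have "\<exists>S \<subseteq> {..<n} \<rightarrow>\<^sub>E {..<q}. card S = 2 ^ B \<and> finite S \<and>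
      (\<forall>f\<in>S. \<forall>g\<in>S. f \<noteq> g \<longrightarrow> card {b. b < n \<and> f b = g b} < B + 1)"
    by (intro greedy_code)
  then obtain S where S: "S \<subseteq> {..<n} \<rightarrow>\<^sub>E {..<q}" "card S = 2 ^ B" "finite S"
    "\<And>f g. \<lbrakk>f \<in> S; g \<in> S; f \<noteq> g\<rbrakk> \<Longrightarrow> card {b. b < n \<and> f b = g b} < B + 1"
    by auto
  obtain h where h: "bij_betw h {0..<2 ^ B :: nat} S"
    using ex_bij_betw_nat_finite[OF S(3)] S(2) by metis
  \<comment> \<open>Slots are numbered from 1, so j - 1 splits into frame number and position within
    the frame.\<close>
  define c where "c m j = (if h m ((j - 1) div q) = (j - 1) mod q then sqrt \<alpha> else 0)" for m j
  have corr: "(\<Sum>j=1..N. c m j * c m' j) = \<alpha> * card {b. b < n \<and> h m b = h m' b}"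
    if "m < 2 ^ B" for m m'
  proof -
    have hm: "h m \<in> {..<n} \<rightarrow>\<^sub>E {..<q}" 
    proof -
      have "h m \<in> S" using bij_betwE[OF h] that by simp
      with S(1) show ?thesis by (rule subsetD)
    qed
    have "(\<Sum>j=1..N. c m j * c m' j) = (\<Sum>i<n * q. c m (i + 1) * c m' (i + 1))"
      unfolding N by (rule sum.reindex_bij_witness[of _ "\<lambda>i. i + 1" "\<lambda>j. j - 1"]) auto
    also have "\<dots> = (\<Sum>b<n. \<Sum>i\<in>{b * q..<b * q + q}. c m (i + 1) * c m' (i + 1))"
      by (rule sum.nat_group[symmetric])
    also have "\<dots> = (\<Sum>b<n. if h m b = h m' b then \<alpha> else 0)"
    proof (rule sum.cong[OF refl])
      fix b assume "b \<in> {..<n}"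
      then have "h m b < q" using hm by auto
      have "(\<Sum>i\<in>{b * q..<b * q + q}. c m (i + 1) * c m' (i + 1)) =
          (\<Sum>r<q. c m (b * q + r + 1) * c m' (b * q + r + 1))"
        by (rule sum.reindex_bij_witness[of _ "\<lambda>r. b * q + r" "\<lambda>i. i - b * q"]) auto
      also have "\<dots> = (\<Sum>r<q. if r = h m b then if h m b = h m' b then \<alpha> else 0 else 0)"
        by (rule sum.cong) (use \<open>\<alpha> \<ge> 0\<close> in \<open>auto simp: c_def\<close>)
      also have "\<dots> = (if h m b = h m' b then \<alpha> else 0)" using \<open>h m b < q\<close> by simp
      finally show "(\<Sum>i\<in>{b * q..<b * q + q}. c m (i + 1) * c m' (i + 1)) =
          (if h m b = h m' b then \<alpha> else 0)" .
    qed
    also have "\<dots> = (\<Sum>b | b < n \<and> h m b = h m' b. \<alpha>)"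
      by (rule sum.mono_neutral_cong_right) auto
    finally show ?thesis by (simp add: mult.commute)
  qed
  have "(\<Sum>j=1..N. (c m j)\<^sup>2) = \<alpha> * (l * (B + 1))" if "m < 2 ^ B" for m
    using corr[OF that, of m] by (simp add: power2_eq_square n_def)
  moreover have "(\<Sum>j=1..N. c m j * c m' j) \<le> \<alpha> * (B + 1)"
    if "m < 2 ^ B" "m' < 2 ^ B" "m \<noteq> m'" for m m'
  proof -
    have "h m \<in> S" "h m' \<in> S" "h m \<noteq> h m'" using h that by (auto simp: bij_betw_def inj_on_def)
    from S(4)[OF this] have "card {b. b < n \<and> h m b = h m' b} \<le> B + 1" by simp
    then have "\<alpha> * card {b. b < n \<and> h m b = h m' b} \<le> \<alpha> * real (B + 1)"
      using assms(2) by (intro mult_left_mono) (simp_all only: of_nat_le_iff)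
    then show ?thesis using corr[OF that(1), of m'] by simp
  qed
  ultimately show ?thesis by blast
qed

subsection \<open>Block-synchronous threshold scheme\<close>

text \<open>Codewords start only at times congruent to A modulo the block length: blocks then never
  overlap a codeword partially, and since A itself is such a time, every message finds an
  admissible start, even when A = 1.\<close>

locale block_code =
  fixes N0 E \<eta> :: real and A M N :: nat and c :: "nat \<Rightarrow> nat \<Rightarrow> real"
  assumes N0: "N0 > 0" and A: "A \<ge> 1" and M: "M \<ge> 1" and N: "N \<ge> 1" and E: "E > 0"
    and \<eta>: "0 < \<eta>" "\<eta> < 1 / 2"
    and energy: "m < M \<Longrightarrow> (\<Sum>j=1..N. (c m j)\<^sup>2) = E"
    and cross: "\<lbrakk>m < M; m' < M; m \<noteq> m'\<rbrakk> \<Longrightarrow> (\<Sum>j=1..N. c m j * c m' j) \<le> \<eta> * E"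
begin

definition grid :: "nat \<Rightarrow> bool" where
  "grid s \<longleftrightarrow> 1 \<le> s \<and> s \<le> A \<and> N dvd (A - s)"

definition shifted :: "nat \<Rightarrow> nat \<Rightarrow> nat \<Rightarrow> real" where
  "shifted s m i = (if s \<le> i \<and> i \<le> s + N - 1 then c m (i - s + 1) else 0)"

text \<open>The correlator has mean E at the true pair and at most \<eta> * E at the competing pairs
  examined up to the true start. The threshold leaves margins \<eta> * E against a miss and (1 - 2 *
  \<eta>) * E against a false alarm.\<close>

definition hit :: "(nat \<Rightarrow> real) \<Rightarrow> nat \<Rightarrow> nat \<Rightarrow> bool" where
  "hit y s m \<longleftrightarrow> m < M \<and> (1 - \<eta>) * E \<le> (\<Sum>i\<in>{1..A + N - 1}. shifted s m i * y i)"

text \<open>The alternatives s = A here and M \<le> m in the decision below only make the LEAST well defined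
  when no block, respectively no message, passes the threshold.\<close>

definition first :: "(nat \<Rightarrow> real) \<Rightarrow> nat" where
  "first y = (LEAST s. grid s \<and> (s = A \<or> (\<exists>m. hit y s m)))"

definition scheme :: ascheme where
  "scheme = \<lparr>len = N, cw = c, start = (\<lambda>t m. LEAST s. grid s \<and> t \<le> s),
     stop = (\<lambda>y. first y + N - 1), dec = (\<lambda>y. LEAST m. hit y (first y) m \<or> M \<le> m)\<rparr>"

lemma scheme_simps [simp]: "len scheme = N" "cw scheme = c"
  "stop scheme y = first y + N - 1" "dec scheme y = (LEAST m. hit y (first y) m \<or> M \<le> m)"
  "horizon A scheme = A + N - 1"
  by (simp_all add: scheme_def horizon_def)

lemma signal_scheme: "signal scheme s m = shifted s m"
  by (simp add: fun_eq_iff signal_def shifted_def)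

lemma grid_A: "grid A" using A by (simp add: grid_def)

text \<open>Distinct grid times differ by a positive multiple of N.\<close>

lemma grid_less: "\<lbrakk>grid s; grid s'; s < s'\<rbrakk> \<Longrightarrow> s + N \<le> s'"
proof -
  assume g: "grid s" "grid s'" "s < s'"
  then have "N dvd (A - s) - (A - s')" unfolding grid_def by - (rule dvd_diff_nat, blast+)
  also have "(A - s) - (A - s') = s' - s" using g by (auto simp: grid_def)
  finally show ?thesis using g(3) by (auto dest: dvd_imp_le)
qed

lemma start_scheme:
  assumes "1 \<le> t" "t \<le> A"
  shows "grid (start scheme t m)" "t \<le> start scheme t m" "start scheme t m < t + N"
proof -
  \<comment> \<open>The largest multiple of N not exceeding A - t; going back by it from A gives the
    witness \<open>s\<close>, so a message waits fewer than N slots.\<close>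
  define k where "k = (A - t) div N * N"
  define s where "s = A - k"
  have "k \<le> A - t" by (simp add: k_def)
  then have s: "A - s = k" "t \<le> s" "s \<le> A" using assms by (auto simp: s_def)
  then have grid: "grid s" using assms by (auto simp: grid_def k_def)
  have "s < t + N"
    using div_mult_mod_eq[of "A - t" N] mod_less_divisor[of N "A - t"] N s assms unfolding k_def by linarith
  moreover have "start scheme t m \<le> s"
    using grid s(2) by (auto simp: scheme_def intro: Least_le)
  ultimately show "start scheme t m < t + N" by simp
  show "grid (start scheme t m)" "t \<le> start scheme t m"
    using LeastI[of "\<lambda>s. grid s \<and> t \<le> s" s] grid s(2) by (simp_all add: scheme_def)
qed

lemma first: "grid (first y)" "first y = A \<or> (\<exists>m. hit y (first y) m)"
  using LeastI[of "\<lambda>s. grid s \<and> (s = A \<or> (\<exists>m. hit y s m))" A] grid_A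
  by (simp_all add: first_def)

lemma hit_cong:
  assumes "\<forall>i\<in>{1..s + N - 1}. y i = y' i"
  shows "hit y s m = hit y' s m"
proof -
  have "(\<Sum>i\<in>{1..A + N - 1}. shifted s m i * y i) = (\<Sum>i\<in>{1..A + N - 1}. shifted s m i * y' i)"
    by (rule sum.cong) (use assms in \<open>auto simp: shifted_def\<close>)
  then show ?thesis by (simp add: hit_def)
qed

text \<open>Causality of the stopping rule: testing starts up to \<open>first y\<close> reads no
  output after the end of the block at \<open>first y\<close>, where the scheme stops.\<close>

lemma first_cong:
  assumes agree: "\<forall>i\<in>{1..first y + N - 1}. y i = y' i"
  shows "first y' = first y"
proof -
  have hit: "hit y s m = hit y' s m" if "s \<le> first y" for s m
    by (rule hit_cong) (use agree that in auto)
  show ?thesis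
    unfolding first_def[of y']
  proof (rule Least_equality)
    show "grid (first y) \<and> (first y = A \<or> (\<exists>m. hit y' (first y) m))"
      using first[of y] hit by auto
    fix s assume s: "grid s \<and> (s = A \<or> (\<exists>m. hit y' s m))"
    show "first y \<le> s"
    proof (rule ccontr)
      assume "\<not> first y \<le> s"
      with s hit have "grid s \<and> (s = A \<or> (\<exists>m. hit y s m))" by auto
      then have "first y \<le> s" unfolding first_def by (rule Least_le)
      with \<open>\<not> first y \<le> s\<close> show False ..
    qed
  qed
qed

lemma hit_measurable [measurable]:
  "Measurable.pred (PiM {1..A + N - 1} (\<lambda>_. borel)) (\<lambda>y. hit y s m)"
  unfolding hit_def by measurable

lemma first_measurable [measurable]:
  "first \<in> measurable (PiM {1..A + N - 1} (\<lambda>_. borel)) (count_space UNIV)"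
  unfolding first_def by measurable

lemma dec_measurable:
  "dec scheme \<in> measurable (PiM {1..A + N - 1} (\<lambda>_. borel)) (count_space UNIV)"
proof -
  \<comment> \<open>Naming the value of \<open>first y\<close> by a countable existential reduces
    measurability to \<open>hit\<close> at a fixed start.\<close>
  have eq: "dec scheme = (\<lambda>y. LEAST m. (\<exists>s. first y = s \<and> hit y s m) \<or> M \<le> m)"
    by (simp add: fun_eq_iff)
  show ?thesis unfolding eq by measurable
qed

lemma stop_measurable:
  "stop scheme \<in> measurable (PiM {1..A + N - 1} (\<lambda>_. borel)) (count_space UNIV)"
proof -
  have eq: "stop scheme = (\<lambda>y. first y + N - 1)"
    by (simp add: fun_eq_iff)
  show ?thesis unfolding eq by measurable
qed

lemma valid_scheme: "valid_scheme A M scheme"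
proof -
  have obs: "obs A scheme = PiM {1..A + N - 1} (\<lambda>_. borel)" by (simp add: obs_def)
  have start: "t \<le> start scheme t m \<and> start scheme t m \<le> A" if "t \<in> {1..A}" for t m
    using start_scheme[of t m] that by (auto simp: grid_def)
  have le: "first y \<le> A" "first y \<ge> 1" for y using first(1)[of y] by (auto simp: grid_def)
  have bound: "stop scheme y \<le> horizon A scheme" for y using le(1)[of y] by simp
  have meas: "{y \<in> space (obs A scheme). stop scheme y = n} \<in> sets (obs A scheme)" for n
    unfolding obs scheme_simps by measurable
  have stop: "stop scheme y' = n" if "\<forall>i\<in>{1..n}. y i = y' i" "stop scheme y = n" for n y y'
    using that first_cong[of y y'] by simp
  have dec: "dec scheme y = dec scheme y'" if "\<forall>i\<in>{1..stop scheme y}. y i = y' i" for y y'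
    using that first_cong[of y y'] hit_cong[of "first y" y y'] by simp
  show ?thesis
    unfolding valid_scheme_def
  proof (intro conjI allI ballI impI)
    show "dec scheme \<in> measurable (obs A scheme) (count_space UNIV)"
      unfolding obs by (rule dec_measurable)
  next
    fix n y y' assume "y \<in> space (obs A scheme) \<and> y' \<in> space (obs A scheme) \<and> (\<forall>i\<in>{1..n}. y i = y' i)"
    then have "\<forall>i\<in>{1..n}. y i = y' i" "\<forall>i\<in>{1..n}. y' i = y i" by auto
    then show "(stop scheme y = n) = (stop scheme y' = n)" using stop by blast
  qed (use N start bound meas dec in \<open>auto simp del: scheme_simps(3-5)\<close>)
qed

section \<open>Error analysis of the threshold decoder\<close>

text \<open>Only false alarms up to the true start can do harm, since the decoder has stopped before
  it would test later blocks.\<close>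

lemma correct_decoding:
  assumes \<sigma>: "grid \<sigma>" and hit: "hit y \<sigma> m"
    and no: "\<And>s m'. \<lbrakk>grid s; s \<le> \<sigma>; (s, m') \<noteq> (\<sigma>, m)\<rbrakk> \<Longrightarrow> \<not> hit y s m'"
  shows "first y = \<sigma>" "dec scheme y = m"
proof -
  show first: "first y = \<sigma>"
    unfolding first_def
  proof (rule Least_equality)
    fix s assume s: "grid s \<and> (s = A \<or> (\<exists>m. hit y s m))"
    show "\<sigma> \<le> s"
    proof (rule ccontr)
      assume "\<not> \<sigma> \<le> s"
      \<comment> \<open>This excludes the default alternative s = A for an earlier s.\<close>
      moreover have "\<sigma> \<le> A" using \<sigma> by (simp add: grid_def)
      ultimately show False using s no[of s] by auto
    qed
  qed (use \<sigma> hit in auto)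
  have "m < M" using hit by (simp add: hit_def)
  then show "dec scheme y = m"
    unfolding scheme_simps first
    by (intro Least_equality) (use hit no[of \<sigma>] \<sigma> in \<open>force+\<close>)
qed

text \<open>Union bound over one miss and at most A * M false alarms, each a Gaussian tail with
  variance \<open>N0 * E / 2\<close>. Waiting for the grid and sending the block together take fewer
  than 2 * N slots.\<close>

lemma failure_prob:
  assumes t: "t \<in> {1..A}" and m: "m < M"
  defines "P \<equiv> out_meas N0 A scheme t m"
  shows "measure P {y \<in> space P. \<not> (dec scheme y = m \<and> stop scheme y \<le> t + 2 * N)} \<le>
    exp (- \<eta>\<^sup>2 * E / N0) + real A * real M * exp (- (1 - 2 * \<eta>)\<^sup>2 * E / N0)"
proof -
  define I where "I = {1..A + N - 1}"
  define \<sigma> where "\<sigma> = start scheme t m"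
  have \<sigma>: "grid \<sigma>" "\<sigma> < t + N" using start_scheme[of t m] t by (auto simp: \<sigma>_def)
  have P: "P = gvec N0 I (shifted \<sigma> m)"
    by (simp add: P_def out_meas_eq I_def \<sigma>_def signal_scheme)
  interpret prob_space P unfolding P by (rule prob_space_gvec) (rule N0)
  have sP [measurable_cong]: "sets P = sets (PiM {1..A + N - 1} (\<lambda>_. borel))"
    by (simp add: P sets_gvec I_def)
  have inner: "(\<Sum>i\<in>I. shifted s m1 i * shifted s m2 i) = (\<Sum>j=1..N. c m1 j * c m2 j)" if "grid s" for s m1 m2
    using sum_signal_mult[of scheme s A m1 m2] that N by (simp add: signal_scheme I_def grid_def)
  have V: "(\<Sum>i\<in>I. (shifted s m' i)\<^sup>2) = E" if "grid s" "m' < M" for s m'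
    using inner[of s m' m'] that energy[of m'] by (simp add: power2_eq_square)
  define S where "S = {(s, m'). grid s \<and> s \<le> \<sigma> \<and> m' < M \<and> (s, m') \<noteq> (\<sigma>, m)}"
  have S: "S \<subseteq> {1..A} \<times> {..<M}" by (auto simp: S_def grid_def)
  have finS: "finite S" by (rule finite_subset[OF S]) simp
  have cardS: "card S \<le> A * M" using card_mono[OF _ S] by (simp add: card_cartesian_product)
  \<comment> \<open>The lower tail is written as an upper tail of the negated correlator so that
    \<open>gvec_chernoff\<close> applies.\<close>
  define miss where "miss = {y \<in> space P. - ((1 - \<eta>) * E) \<le> (\<Sum>i\<in>I. - shifted \<sigma> m i * y i)}"
  define alarm where "alarm p = {y \<in> space P. hit y (fst p) (snd p)}" for p
  have ev: "miss \<in> events" "alarm p \<in> events" for p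
    unfolding miss_def alarm_def I_def by measurable
  have UN: "(\<Union>p\<in>S. alarm p) \<in> events" using ev finS by auto
  have "{y \<in> space P. \<not> (dec scheme y = m \<and> stop scheme y \<le> t + 2 * N)} \<subseteq> miss \<union> (\<Union>p\<in>S. alarm p)"
  proof (rule subsetI, rule ccontr)
    fix y assume y: "y \<in> {y \<in> space P. \<not> (dec scheme y = m \<and> stop scheme y \<le> t + 2 * N)}"
      and out: "y \<notin> miss \<union> (\<Union>p\<in>S. alarm p)"
    have "hit y \<sigma> m" using y out m by (auto simp: miss_def hit_def I_def sum_negf)
    moreover have "\<not> hit y s m'" if "grid s" "s \<le> \<sigma>" "(s, m') \<noteq> (\<sigma>, m)" for s m'
    proof
      assume h: "hit y s m'"
      then have "(s, m') \<in> S" using that by (auto simp: S_def hit_def)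
      moreover have "y \<in> alarm (s, m')" using h y by (simp add: alarm_def)
      ultimately show False using out by blast
    qed
    ultimately have "first y = \<sigma>" "dec scheme y = m"
      using correct_decoding[OF \<sigma>(1)] by blast+
    then show False using y \<sigma>(2) by auto
  qed
  then have "prob {y \<in> space P. \<not> (dec scheme y = m \<and> stop scheme y \<le> t + 2 * N)} \<le>
      prob (miss \<union> (\<Union>p\<in>S. alarm p))"
    by (rule finite_measure_mono) (intro sets.Un ev UN)
  also have "\<dots> \<le> prob miss + prob (\<Union>p\<in>S. alarm p)"
    by (intro measure_Un_le ev UN)
  also have "prob (\<Union>p\<in>S. alarm p) \<le> (\<Sum>p\<in>S. prob (alarm p))"
    by (rule measure_UNION_le) (use finS ev in auto)
  also have "\<dots> \<le> (\<Sum>p\<in>S. exp (- (1 - 2 * \<eta>)\<^sup>2 * E / N0))"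
  proof (rule sum_mono)
    fix p assume "p \<in> S"
    then obtain s m' where p: "p = (s, m')" "grid s" "s \<le> \<sigma>" "m' < M" "(s, m') \<noteq> (\<sigma>, m)"
      by (auto simp: S_def)
    \<comment> \<open>In the same block the messages differ and \<open>cross\<close> applies; an
      earlier grid block is disjoint from the transmitted one.\<close>
    have corr: "(\<Sum>i\<in>I. shifted s m' i * shifted \<sigma> m i) \<le> \<eta> * E"
    proof (cases "s = \<sigma>")
      case True
      then show ?thesis using inner[of \<sigma> m' m] \<sigma> p cross[of m' m] m by auto
    next
      case False
      then have "s + N \<le> \<sigma>" using grid_less[of s \<sigma>] p \<sigma> by simp
      then have "(\<Sum>i\<in>I. shifted s m' i * shifted \<sigma> m i) = 0"
        by (intro sum.neutral) (use N in \<open>auto simp: shifted_def\<close>)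
      then show ?thesis using \<eta> E by simp
    qed
    have "prob (alarm p) \<le> prob {y \<in> space P. (1 - \<eta>) * E \<le> (\<Sum>i\<in>I. shifted s m' i * y i)}"
      by (rule finite_measure_mono) (auto simp: alarm_def p hit_def I_def)
    also have "\<dots> \<le> exp (- ((1 - \<eta>) * E - \<eta> * E)\<^sup>2 / (N0 * E))"
      unfolding P
    proof (rule gvec_chernoff[OF N0 _ V E corr])
      have "0 \<le> (1 - 2 * \<eta>) * E" using \<eta> E by simp
      then show "\<eta> * E \<le> (1 - \<eta>) * E" by (simp add: algebra_simps)
    qed (use p in \<open>auto simp: I_def\<close>)
    also have "- ((1 - \<eta>) * E - \<eta> * E)\<^sup>2 / (N0 * E) = - (1 - 2 * \<eta>)\<^sup>2 * E / N0"
      using E N0 by (simp add: field_simps power2_eq_square)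
    finally show "prob (alarm p) \<le> exp (- (1 - 2 * \<eta>)\<^sup>2 * E / N0)" .
  qed
  also have "\<dots> \<le> real A * real M * exp (- (1 - 2 * \<eta>)\<^sup>2 * E / N0)"
    using cardS by (simp flip: of_nat_mult)
  also have "prob miss \<le> exp (- (- ((1 - \<eta>) * E) - - E)\<^sup>2 / (N0 * E))"
    unfolding miss_def P
  proof (rule gvec_chernoff[OF N0 _ _ E])
    show "(\<Sum>i\<in>I. (- shifted \<sigma> m i)\<^sup>2) = E" using V[OF \<sigma>(1) m] by simp
    show "(\<Sum>i\<in>I. - shifted \<sigma> m i * shifted \<sigma> m i) \<le> - E"
      using V[OF \<sigma>(1) m] by (simp add: sum_negf power2_eq_square)
    show "- E \<le> - ((1 - \<eta>) * E)" using \<eta> E by (simp add: algebra_simps)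
  qed (simp add: I_def)
  also have "- (- ((1 - \<eta>) * E) - - E)\<^sup>2 / (N0 * E) = - \<eta>\<^sup>2 * E / N0"
    using E N0 by (simp add: field_simps power2_eq_square)
  finally show ?thesis by simp
qed

text \<open>The single event \<open>?bad\<close> covers both a wrong decision and lateness. Its
  bound is uniform in t and m, so it survives the average over t and holds for every m.\<close>

lemma scheme_performance:
  assumes eps: "eps \<ge> exp (- \<eta>\<^sup>2 * E / N0) + real A * real M * exp (- (1 - 2 * \<eta>)\<^sup>2 * E / N0)"
  shows "err_prob N0 A M scheme \<le> eps" "delay N0 A M scheme eps \<le> 2 * N" "cost M scheme = E"
proof -
  let ?P = "out_meas N0 A scheme"
  let ?bad = "\<lambda>t m. {y \<in> space (?P t m). \<not> (dec scheme y = m \<and> stop scheme y \<le> t + 2 * N)}"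
  have ne: "{..<M} \<noteq> {}" using M by (simp add: lessThan_empty_iff)
  have obs: "sets (?P t m) = sets (PiM {1..A + N - 1} (\<lambda>_. borel))" for t m
    by (simp add: out_meas_eq sets_gvec)
  have [measurable]: "dec scheme \<in> measurable (?P t m) (count_space UNIV)"
    "stop scheme \<in> measurable (?P t m) (count_space UNIV)" for t m
    unfolding measurable_cong_sets[OF obs refl] by (rule dec_measurable stop_measurable)+
  have bad: "measure (?P t m) (?bad t m) \<le> eps" if "t \<in> {1..A}" "m < M" for t m
    using failure_prob[OF that] eps by simp
  have bad_sets: "?bad t m \<in> sets (?P t m)" for t m by measurable
  have err: "measure (?P t m) {y \<in> space (?P t m). dec scheme y \<noteq> m} \<le> eps"
    if "t \<in> {1..A}" "m < M" for t m
  proof -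
    interpret prob_space "?P t m" unfolding out_meas_eq by (rule prob_space_gvec) (rule N0)
    have "prob {y \<in> space (?P t m). dec scheme y \<noteq> m} \<le> prob (?bad t m)"
      using bad_sets by (intro finite_measure_mono) auto
    with bad[OF that] show ?thesis by simp
  qed
  have del: "1 - eps \<le> measure (?P t m) {y \<in> space (?P t m). int (stop scheme y) - int t \<le> int (2 * N)}"
    if "t \<in> {1..A}" "m < M" for t m
  proof -
    interpret prob_space "?P t m" unfolding out_meas_eq by (rule prob_space_gvec) (rule N0)
    have "1 - eps \<le> prob (space (?P t m) - ?bad t m)"
      using bad[OF that] bad_sets by (subst prob_compl) auto
    also have "\<dots> \<le> prob {y \<in> space (?P t m). int (stop scheme y) - int t \<le> int (2 * N)}"
    proof (rule finite_measure_mono)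
      have "{y \<in> space (?P t m). int (stop scheme y) - int t \<le> int (2 * N)} =
          {y \<in> space (?P t m). stop scheme y \<le> t + 2 * N}" by auto
      also have "\<dots> \<in> events" by measurable
      finally show "{y \<in> space (?P t m). int (stop scheme y) - int t \<le> int (2 * N)} \<in> events" .
    qed auto
    finally show ?thesis .
  qed
  show "err_prob N0 A M scheme \<le> eps"
    unfolding err_prob_def
  proof (rule Max.boundedI)
    fix x assume "x \<in> (\<lambda>m. (\<Sum>t=1..A. measure (?P t m) {y\<in>space (?P t m). dec scheme y \<noteq> m}) / real A) ` {..<M}"
    then obtain m where m: "m < M"
      and x: "x = (\<Sum>t=1..A. measure (?P t m) {y\<in>space (?P t m). dec scheme y \<noteq> m}) / real A" by auto
    have "(\<Sum>t=1..A. measure (?P t m) {y\<in>space (?P t m). dec scheme y \<noteq> m}) \<le> (\<Sum>t=1..A. eps)"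
      by (intro sum_mono err m)
    then show "x \<le> eps" unfolding x using A by (simp add: field_simps)
  qed (use ne in auto)
  have "1 - eps \<le> delay_prob N0 A scheme m (2 * N)" if m: "m < M" for m
  proof -
    have "(\<Sum>t=1..A. 1 - eps) \<le> (\<Sum>t=1..A. measure (?P t m)
        {y \<in> space (?P t m). int (stop scheme y) - int t \<le> int (2 * N)})"
      by (intro sum_mono del m)
    then show ?thesis unfolding delay_prob_def using A by (simp add: field_simps)
  qed
  then show "delay N0 A M scheme eps \<le> 2 * N"
    unfolding delay_def by (intro Least_le) auto
  have "(\<lambda>m. \<Sum>i=1..len scheme. (cw scheme m i)\<^sup>2) ` {..<M} = {E}"
    using energy M by (auto simp: image_iff intro!: exI[of _ 0])
  then show "cost M scheme = E" unfolding cost_def by simp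
qed

end

section \<open>Choice of parameters and asymptotics of achievability\<close>

text \<open>The number of hypotheses grows like exp (\<kappa> * B), and each false alarm decays like
  exp (- \<theta> * B). As l grows, \<theta> tends to 1 / (R * N0), which exceeds \<kappa>. A fixed
  large l therefore suffices and keeps the delay linear in B.\<close>

lemma achievable_below_capacity:
  assumes "N0 > 0" "\<beta> \<ge> 0" "R > 0" and R: "R * ((1 + \<beta>) * ln 2 * N0) < 1"
  shows "achievable N0 \<beta> 0 R"
proof -
  define \<kappa> where "\<kappa> = (1 + \<beta>) * ln 2"
  have "\<kappa> < 1 / (R * N0)" using assms by (simp add: \<kappa>_def field_simps)
  moreover have "(\<lambda>l. (1 - 2 * (1 / real l))\<^sup>2) \<longlonglongrightarrow> 1" by real_asymp
  then have "(\<lambda>l. (1 - 2 * (1 / real l))\<^sup>2 / (R * N0)) \<longlonglongrightarrow> 1 / (R * N0)"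
    using assms by (intro tendsto_intros) auto
  ultimately have "eventually (\<lambda>l. \<kappa> < (1 - 2 * (1 / real l))\<^sup>2 / (R * N0)) sequentially"
    by (intro order_tendstoD)
  then have "eventually (\<lambda>l. \<kappa> < (1 - 2 * (1 / real l))\<^sup>2 / (R * N0) \<and> l \<ge> 3) sequentially"
    using eventually_ge_at_top by (rule eventually_conj)
  \<comment> \<open>The requirement that l be at least 3 makes \<eta> = 1 / l smaller than
    1/2.\<close>
  then obtain l :: nat where l: "\<kappa> < (1 - 2 * (1 / real l))\<^sup>2 / (R * N0)" "l \<ge> 3"
    using eventually_happens'[OF sequentially_bot] by blast
  define \<eta> where "\<eta> = 1 / real l"
  define \<theta> where "\<theta> = (1 - 2 * \<eta>)\<^sup>2 / (R * N0)"
  \<comment> \<open>Using B + 1 instead of B keeps the energy positive at B = 0; the slack in the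
    rate condition absorbs the excess.\<close>
  define E where "E B = real (B + 1) / R" for B
  define A where "A B = asyn \<beta> B" for B
  define N where "N B = l * (B + 1) * 2 ^ (l + 1)" for B
  define eps where "eps B = exp (- \<eta>\<^sup>2 * E B / N0) +
    real (A B) * real (2 ^ B) * exp (- (1 - 2 * \<eta>)\<^sup>2 * E B / N0)" for B
  have \<eta>: "0 < \<eta>" "\<eta> < 1 / 2" using l(2) by (auto simp: \<eta>_def field_simps)
  have \<theta>: "\<kappa> < \<theta>" using l(1) by (simp add: \<theta>_def \<eta>_def)

  have "\<exists>C. valid_scheme (A B) (2 ^ B) C \<and> err_prob N0 (A B) (2 ^ B) C \<le> eps B \<and>
      delay N0 (A B) (2 ^ B) C (eps B) \<le> 2 * N B \<and> cost (2 ^ B) C = E B" for B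
  proof -
    \<comment> \<open>The energy \<open>E B\<close> divided evenly among the l * (B + 1)
      pulses.\<close>
    define \<alpha> where "\<alpha> = 1 / (R * real l)"
    have "\<alpha> \<ge> 0" "l \<ge> 1" using assms l(2) by (auto simp: \<alpha>_def)
    from ppm_codebook[OF this(2,1), of B, folded N_def] obtain c :: "nat \<Rightarrow> nat \<Rightarrow> real"
      where c': "\<forall>m<2 ^ B. (\<Sum>j=1..N B. (c m j)\<^sup>2) = \<alpha> * (l * (B + 1))"
        "\<forall>m<2 ^ B. \<forall>m'<2 ^ B. m \<noteq> m' \<longrightarrow> (\<Sum>j=1..N B. c m j * c m' j) \<le> \<alpha> * (B + 1)"
      by (elim exE conjE)
    note c = c'(1)[rule_format] c'(2)[rule_format]
    have 1: "\<alpha> * (l * (B + 1)) = E B" "\<alpha> * (B + 1) = \<eta> * E B"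
      using l(2) assms(3) by (simp_all add: \<alpha>_def E_def \<eta>_def field_simps)
    interpret block_code N0 "E B" \<eta> "A B" "2 ^ B" "N B" c
    proof
      show "E B > 0" using assms by (simp add: E_def)
      show "A B \<ge> 1" unfolding A_def by (rule asyn_ge_1[OF assms(2)])
      show "N B \<ge> 1" using l(2) by (simp add: N_def)
    qed (use c[unfolded 1] \<eta> assms in auto)
    show ?thesis using valid_scheme scheme_performance[of "eps B"] by (auto simp: eps_def)
  qed
  then obtain C where C: "\<And>B. valid_scheme (A B) (2 ^ B) (C B)"
    "\<And>B. err_prob N0 (A B) (2 ^ B) (C B) \<le> eps B"
    "\<And>B. delay N0 (A B) (2 ^ B) (C B) (eps B) \<le> 2 * N B" "\<And>B. cost (2 ^ B) (C B) = E B"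
    by metis

  have "eps \<longlonglongrightarrow> 0"
  proof (rule tendsto_sandwich)
    show "eventually (\<lambda>B. 0 \<le> eps B) sequentially" by (simp add: eps_def)
    show "eventually (\<lambda>B. eps B \<le> exp (- \<eta>\<^sup>2 * (real B + 1) / (R * N0)) + 2 * exp (- (\<theta> - \<kappa>) * real B)) sequentially"
    proof (rule always_eventually, rule allI)
      fix B
      have "real (A B) * real (2 ^ B) * exp (- \<theta> * real (B + 1)) \<le>
          2 * 2 powr (\<beta> * real B) * 2 powr real B * exp (- \<theta> * real B)"
      proof (intro mult_mono)
        have "0 \<le> \<kappa>" using assms by (simp add: \<kappa>_def)
        then have "\<theta> * real B \<le> \<theta> * real (B + 1)" using \<theta> by (intro mult_left_mono) auto
        then show "exp (- \<theta> * real (B + 1)) \<le> exp (- \<theta> * real B)" by simp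
      qed (use asyn_le[OF assms(2), of B] in \<open>auto simp: A_def powr_realpow\<close>)
      also have "2 * 2 powr (\<beta> * real B) * 2 powr real B * exp (- \<theta> * real B) =
          2 * exp (- (\<theta> - \<kappa>) * real B)"
        by (simp add: powr_def \<kappa>_def algebra_simps flip: exp_add)
      finally show "eps B \<le> exp (- \<eta>\<^sup>2 * (real B + 1) / (R * N0)) + 2 * exp (- (\<theta> - \<kappa>) * real B)"
        by (simp add: eps_def E_def \<theta>_def add.commute)
    qed
    define a where "a = \<eta>\<^sup>2 / (R * N0)"
    define b where "b = \<theta> - \<kappa>"
    have ab: "a > 0" "b > 0" using assms \<eta> \<theta> by (auto simp: a_def b_def)
    have "(\<lambda>B. exp (- a * (real B + 1))) \<longlonglongrightarrow> 0" using ab(1) by real_asymp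
    moreover have "(\<lambda>B. 2 * exp (- b * real B)) \<longlonglongrightarrow> 0" using ab(2) by real_asymp
    ultimately have "(\<lambda>B. exp (- a * (real B + 1)) + 2 * exp (- b * real B)) \<longlonglongrightarrow> 0"
      by (rule tendsto_add_zero)
    then show "(\<lambda>B. exp (- \<eta>\<^sup>2 * (real B + 1) / (R * N0)) + 2 * exp (- (\<theta> - \<kappa>) * real B)) \<longlonglongrightarrow> 0"
      by (simp add: a_def b_def)
  qed simp
  moreover have "eventually (\<lambda>B. real (delay N0 (A B) (2 ^ B) (C B) (eps B)) \<le> 2 powr ((0 + e) * real B)) sequentially"
    if "e > 0" for e
  proof -
    define k :: real where "k = 2 * real l * 2 ^ (l + 1)"
    have "k > 0" using l(2) by (simp add: k_def)
    with that have "eventually (\<lambda>B. k * (real B + 1) \<le> 2 powr (e * real B)) sequentially"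
      by real_asymp
    then show ?thesis
    proof eventually_elim
      case (elim B)
      have "real (delay N0 (A B) (2 ^ B) (C B) (eps B)) \<le> real (2 * N B)"
        using C(3) by (rule of_nat_mono)
      also have "\<dots> = k * (real B + 1)" by (simp add: N_def k_def algebra_simps)
      finally show ?case using elim by simp
    qed
  qed
  moreover have "eventually (\<lambda>B. (R - e) * cost (2 ^ B) (C B) \<le> real B) sequentially" if "e > 0" for e
  proof -
    have "eventually (\<lambda>B. R \<le> e * (real B + 1)) sequentially"
      using that by real_asymp
    then show ?thesis
    proof eventually_elim
      case (elim B)
      then have "(R - e) * (real B + 1) \<le> R * real B" by (simp add: algebra_simps)
      then show ?case using assms(3) by (simp add: C(4) E_def field_simps)
    qed
  qed
  ultimately show ?thesis
    unfolding achievable_def using C(1,2) unfolding A_def by blast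
qed

theorem theorem3:
  fixes N0 \<beta> :: real
  assumes "N0 > 0" and "\<beta> \<ge> 0"
  shows "async_capacity N0 \<beta> 0 = 1 / (1 + \<beta>) * (log 2 (exp 1) / N0)"
  unfolding async_capacity_def
proof (rule cSup_eq)
  fix R assume "R \<in> {R. achievable N0 \<beta> 0 R}"
  then show "R \<le> 1 / (1 + \<beta>) * (log 2 (exp 1) / N0)"
    using achievable_le_capacity[OF assms] by simp
next
  fix u assume u: "\<And>R. R \<in> {R. achievable N0 \<beta> 0 R} \<Longrightarrow> R \<le> u"
  have "1 / ((1 + \<beta>) * ln 2 * N0) \<le> u"
  \<comment> \<open>Achievability is available for positive R strictly below the claimed value;
    density of the reals carries the bound to the endpoint.\<close>
  proof (rule dense_le_bounded[of 0])
    show "0 < 1 / ((1 + \<beta>) * ln 2 * N0)" using assms by simp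
    fix R assume "0 < R" "R < 1 / ((1 + \<beta>) * ln 2 * N0)"
    then have "achievable N0 \<beta> 0 R"
      using assms by (intro achievable_below_capacity) (auto simp: pos_less_divide_eq)
    then show "R \<le> u" using u by simp
  qed
  then show "1 / (1 + \<beta>) * (log 2 (exp 1) / N0) \<le> u" by (simp add: log_def)
qed

end
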